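(* Let $k$ be an algebraically closed field and let $Q,Q'$ be finite, connected, acyclic quivers. The category $Rep_{(Q,Q')}$ of birepresentations of $(Q,Q')$ is complete, and the forgetful functor $\mathcal{U}: Rep_{(Q,Q')}\to Rep_k(Q)\times Rep_k(Q')$, $(V,V',\psi)\mapsto (V,V')$, is continuous (preserves all small limits). Furthermore, limits in $Rep_{(Q,Q')}$ can be obtained by the corresponding construction in $Rep_k(Q)\times Rep_k(Q')$: if $\mathscr{D}$ is a small category, $\mathscr{F}:\mathscr{D}\to Rep_{(Q,Q')}$ is a functor, and $(L,(\eta^D)_{D\in\mathscr{D}})$, $(L',(\eta'^D)_{D\in\mathscr{D}})$ are limits of the composites of $\mathcal{U}\mathscr{F}$ with the two projections to $Rep_k(Q)$ and $Rep_k(Q')$, then there is a family $\psi'$ of $k$-linear maps such that $(L,L',\psi')$ is a birepresentation which, together with the morphisms $(\eta^D,\eta'^D)_{D\in\mathscr{D}}$, is a limit of $\mathscr{F}$.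
   Context: A quiver $Q=(Q_0,Q_1,s,t)$ has vertex set $Q_0$, arrow set $Q_1$, and source and target maps $s,t:Q_1\to Q_0$. $Rep_k(Q)$ is the category of $k$-linear representations $M=(M_i,\varphi_\alpha)_{i\in Q_0,\alpha\in Q_1}$ of $Q$ ($k$-vector spaces $M_i$ and $k$-linear maps $\varphi_\alpha:M_{s(\alpha)}\to M_{t(\alpha)}$, not necessarily finite dimensional); morphisms are families of linear maps $f_i$ commuting with the structure maps. A birepresentation (or $2$-representation) of $(Q,Q')$ is a triple $(V,V',\psi)$ with $V\in Rep_k(Q)$, $V'\in Rep_k(Q')$ and $\psi=(\psi^\alpha_\beta)$ a family of $k$-linear maps $\psi^\alpha_\beta:V_{t(\alpha)}\to V'_{s(\beta)}$, one for each pair $(\alpha,\beta)\in Q_1\times Q'_1$ (no further condition). A morphism $(V,V',\psi)\to (W,W',\theta)$ is a pair $(f,f')$ of morphisms $f:V\to W$ in $Rep_k(Q)$ and $f':V'\to W'$ in $Rep_k(Q')$ with $f'_{s(\beta)}\psi^\alpha_\beta=\theta^\alpha_\beta f_{t(\alpha)}$ for all $(\alpha,\beta)\in Q_1\times Q'_1$. Composition is componentwise. *)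

theory Defs
  imports
    "HOL-Algebra.Module"
    "HOL-Algebra.Algebraic_Closure"
    "HOL-Library.Equipollence"
    "Graph_Theory.Arc_Walk"
    "Graph_Theory.Digraph_Component"
begin

section \<open>Categories, functors and limits\<close>

text \<open>
  Hom-sets are indexed by their source and target and need not be disjoint; therefore composition
  and the arrow part of a functor take the objects as arguments.
  \<open>Comp C x y z g f\<close> is \<open>g \<circ> f\<close> for \<open>f : x \<rightarrow> y\<close> and \<open>g : y \<rightarrow> z\<close>.
\<close>

record ('o, 'm) cat =
  Obj :: "'o set"
  Arr :: "'o \<Rightarrow> 'o \<Rightarrow> 'm set"
  Comp :: "'o \<Rightarrow> 'o \<Rightarrow> 'o \<Rightarrow> 'm \<Rightarrow> 'm \<Rightarrow> 'm"
  Ident :: "'o \<Rightarrow> 'm"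

locale category =
  fixes C :: "('o, 'm) cat"
  assumes ident_closed: "x \<in> Obj C \<Longrightarrow> Ident C x \<in> Arr C x x"
    and comp_closed:
      "\<lbrakk>x \<in> Obj C; y \<in> Obj C; z \<in> Obj C; f \<in> Arr C x y; g \<in> Arr C y z\<rbrakk>
        \<Longrightarrow> Comp C x y z g f \<in> Arr C x z"
    and comp_ident_right:
      "\<lbrakk>x \<in> Obj C; y \<in> Obj C; f \<in> Arr C x y\<rbrakk> \<Longrightarrow> Comp C x x y f (Ident C x) = f"
    and comp_ident_left:
      "\<lbrakk>x \<in> Obj C; y \<in> Obj C; f \<in> Arr C x y\<rbrakk> \<Longrightarrow> Comp C x y y (Ident C y) f = f"
    and comp_assoc:
      "\<lbrakk>w \<in> Obj C; x \<in> Obj C; y \<in> Obj C; z \<in> Obj C;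
        f \<in> Arr C w x; g \<in> Arr C x y; h \<in> Arr C y z\<rbrakk>
        \<Longrightarrow> Comp C w y z h (Comp C w x y g f) = Comp C w x z (Comp C x y z h g) f"

record ('o, 'm, 'p, 'n) fctr =
  FObj :: "'o \<Rightarrow> 'p"
  FArr :: "'o \<Rightarrow> 'o \<Rightarrow> 'm \<Rightarrow> 'n"

locale is_functor = src: category C + trg: category D
  for C :: "('o, 'm) cat" and D :: "('p, 'n) cat" +
  fixes F :: "('o, 'm, 'p, 'n) fctr"
  assumes obj_closed: "x \<in> Obj C \<Longrightarrow> FObj F x \<in> Obj D"
    and arr_closed:
      "\<lbrakk>x \<in> Obj C; y \<in> Obj C; f \<in> Arr C x y\<rbrakk>
        \<Longrightarrow> FArr F x y f \<in> Arr D (FObj F x) (FObj F y)"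
    and pres_ident: "x \<in> Obj C \<Longrightarrow> FArr F x x (Ident C x) = Ident D (FObj F x)"
    and pres_comp:
      "\<lbrakk>x \<in> Obj C; y \<in> Obj C; z \<in> Obj C; f \<in> Arr C x y; g \<in> Arr C y z\<rbrakk>
        \<Longrightarrow> FArr F x z (Comp C x y z g f)
            = Comp D (FObj F x) (FObj F y) (FObj F z) (FArr F y z g) (FArr F x y f)"

definition comp_fctr ::
  "('p, 'n, 'q, 'l) fctr \<Rightarrow> ('o, 'm, 'p, 'n) fctr \<Rightarrow> ('o, 'm, 'q, 'l) fctr" (infixr \<open>\<circ>\<^sub>F\<close> 55) where
  "G \<circ>\<^sub>F F = \<lparr>FObj = (\<lambda>x. FObj G (FObj F x)),
             FArr = (\<lambda>x y f. FArr G (FObj F x) (FObj F y) (FArr F x y f))\<rparr>"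

definition prod_cat :: "('o, 'm) cat \<Rightarrow> ('p, 'n) cat \<Rightarrow> ('o \<times> 'p, 'm \<times> 'n) cat" where
  "prod_cat C D = \<lparr>
     Obj = Obj C \<times> Obj D,
     Arr = (\<lambda>x y. Arr C (fst x) (fst y) \<times> Arr D (snd x) (snd y)),
     Comp = (\<lambda>x y z g f. (Comp C (fst x) (fst y) (fst z) (fst g) (fst f),
                          Comp D (snd x) (snd y) (snd z) (snd g) (snd f))),
     Ident = (\<lambda>x. (Ident C (fst x), Ident D (snd x)))\<rparr>"

definition fst_fctr :: "('o \<times> 'p, 'm \<times> 'n, 'o, 'm) fctr" where
  "fst_fctr = \<lparr>FObj = fst, FArr = (\<lambda>x y. fst)\<rparr>"

definition snd_fctr :: "('o \<times> 'p, 'm \<times> 'n, 'p, 'n) fctr" where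
  "snd_fctr = \<lparr>FObj = snd, FArr = (\<lambda>x y. snd)\<rparr>"

definition is_cone ::
  "('d, 'e) cat \<Rightarrow> ('o, 'm) cat \<Rightarrow> ('d, 'e, 'o, 'm) fctr \<Rightarrow> 'o \<Rightarrow> ('d \<Rightarrow> 'm) \<Rightarrow> bool" where
  "is_cone D C F L \<eta> \<longleftrightarrow>
     L \<in> Obj C \<and>
     (\<forall>d\<in>Obj D. \<eta> d \<in> Arr C L (FObj F d)) \<and>
     (\<forall>d\<in>Obj D. \<forall>d'\<in>Obj D. \<forall>f\<in>Arr D d d'.
        Comp C L (FObj F d) (FObj F d') (FArr F d d' f) (\<eta> d) = \<eta> d')"

definition is_limit ::
  "('d, 'e) cat \<Rightarrow> ('o, 'm) cat \<Rightarrow> ('d, 'e, 'o, 'm) fctr \<Rightarrow> 'o \<Rightarrow> ('d \<Rightarrow> 'm) \<Rightarrow> bool" where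
  "is_limit D C F L \<eta> \<longleftrightarrow>
     is_cone D C F L \<eta> \<and>
     (\<forall>M \<mu>. is_cone D C F M \<mu> \<longrightarrow>
        (\<exists>!h. h \<in> Arr C M L \<and> (\<forall>d\<in>Obj D. Comp C M L (FObj F d) (\<eta> d) h = \<mu> d)))"

subsection \<open>Smallness\<close>

text \<open>
  HOL has no type of all sets, so size questions are treated relative to a universe, given here by
  a type \<open>'u\<close>: the vector spaces below are those whose carrier is a subset of \<open>'u\<close>.  As in a
  Grothendieck universe, products over small index sets must not leave the universe, and a set
  \<open>I\<close> is called small if the \<open>I\<close>-fold power of the universe is no larger than the universe.
  Lemma \<open>small_exponential\<close> shows that any prescribed index set is small in a suitable universe
  that contains a copy of any prescribed type \<open>'c\<close>.
\<close>

definition small :: "'u itself \<Rightarrow> 'i set \<Rightarrow> bool" where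
  "small _ I \<longleftrightarrow> (I \<rightarrow>\<^sub>E (UNIV :: 'u set)) \<lesssim> (UNIV :: 'u set)"

lemma small_exponential:
  fixes I :: "'j set"
  assumes "I \<lesssim> (UNIV :: 'i set)"
  shows "small TYPE('i \<times> nat \<Rightarrow> 'c) I"
proof -
  obtain e :: "'j \<Rightarrow> 'i" where e: "inj_on e I"
    using assms by (auto simp: lepoll_def)
  have "infinite (UNIV :: ('i \<times> nat) set)"
    by (simp add: finite_prod)
  then obtain b :: "('i \<times> nat) \<times> ('i \<times> nat) \<Rightarrow> 'i \<times> nat" where b: "inj b"
    using card_of_Times_same_infinite[of "UNIV :: ('i \<times> nat) set"]
    by (auto simp flip: card_of_ordIso simp: bij_betw_def)
  define H :: "('j \<Rightarrow> ('i \<times> nat \<Rightarrow> 'c)) \<Rightarrow> ('i \<times> nat \<Rightarrow> 'c)" where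
    "H g = (\<lambda>q. g (inv_into I e (fst (fst (inv_into UNIV b q)))) (snd (inv_into UNIV b q)))" for g
  have H: "H g (b ((e j, 0), p)) = g j p" if "j \<in> I" for g j p
    using that e b by (simp add: H_def)
  have "inj_on H (I \<rightarrow>\<^sub>E UNIV)"
  proof (rule inj_onI)
    fix g g' assume g: "g \<in> I \<rightarrow>\<^sub>E UNIV" "g' \<in> I \<rightarrow>\<^sub>E UNIV" and eq: "H g = H g'"
    have "g j = g' j" if "j \<in> I" for j
      using H[OF that, of g] H[OF that, of g'] eq by auto
    then show "g = g'"
      using g by (metis PiE_ext)
  qed
  then show ?thesis
    by (auto simp: small_def lepoll_def)
qed

definition small_category :: "'u itself \<Rightarrow> ('d, 'e) cat \<Rightarrow> bool" where
  "small_category U D \<longleftrightarrow>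
     category D \<and> small U (Obj D) \<and> small U (SIGMA x : Obj D. SIGMA y : Obj D. Arr D x y)"

text \<open>
  HOL formulas cannot quantify over types, so the types \<open>'d\<close>, \<open>'e\<close> from which the objects and
  arrows of the indexing categories are taken are parameters.
\<close>

definition complete_category ::
  "'u itself \<Rightarrow> 'd itself \<Rightarrow> 'e itself \<Rightarrow> ('o, 'm) cat \<Rightarrow> bool" where
  "complete_category U _ _ C \<longleftrightarrow>
     category C \<and>
     (\<forall>(D :: ('d, 'e) cat) F. small_category U D \<longrightarrow> is_functor D C F \<longrightarrow>
        (\<exists>L \<eta>. is_limit D C F L \<eta>))"

definition continuous_functor ::
  "'u itself \<Rightarrow> 'd itself \<Rightarrow> 'e itself \<Rightarrow> ('o, 'm) cat \<Rightarrow> ('p, 'n) cat \<Rightarrow> ('o, 'm, 'p, 'n) fctr \<Rightarrow> bool"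
  where
  "continuous_functor U _ _ C C' G \<longleftrightarrow>
     is_functor C C' G \<and>
     (\<forall>(D :: ('d, 'e) cat) F L \<eta>. small_category U D \<longrightarrow> is_functor D C F \<longrightarrow>
        is_limit D C F L \<eta> \<longrightarrow>
        is_limit D C' (G \<circ>\<^sub>F F) (FObj G L) (\<lambda>d. FArr G L (FObj F d) (\<eta> d)))"

section \<open>Representations of quivers\<close>

text \<open>
  A quiver is a well-formed digraph (multiple arrows and loops being allowed) in which \<open>tail\<close> and
  \<open>head\<close> are the source and target maps.
\<close>

definition acyclic_quiver :: "('v, 'a) pre_digraph \<Rightarrow> bool" where
  "acyclic_quiver Q \<longleftrightarrow> \<not> (\<exists>p. pre_digraph.cycle Q p)"

text \<open>
  Vector spaces are modules over a field; the fields \<open>mult\<close> and \<open>one\<close> of the record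
  type \<open>module\<close> play no role.  Linear maps are extensional functions.
\<close>

definition linear_maps ::
  "('k, 'x) ring_scheme \<Rightarrow> ('k, 'u) module \<Rightarrow> ('k, 'u) module \<Rightarrow> ('u \<Rightarrow> 'u) set" where
  "linear_maps k M N = {f \<in> carrier M \<rightarrow>\<^sub>E carrier N.
     (\<forall>x\<in>carrier M. \<forall>y\<in>carrier M. f (x \<oplus>\<^bsub>M\<^esub> y) = f x \<oplus>\<^bsub>N\<^esub> f y) \<and>
     (\<forall>c\<in>carrier k. \<forall>x\<in>carrier M. f (c \<odot>\<^bsub>M\<^esub> x) = c \<odot>\<^bsub>N\<^esub> f x)}"

record ('v, 'a, 'k, 'u) rep =
  Space :: "'v \<Rightarrow> ('k, 'u) module"
  Map :: "'a \<Rightarrow> 'u \<Rightarrow> 'u"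

definition reps ::
  "('k, 'x) ring_scheme \<Rightarrow> ('v, 'a) pre_digraph \<Rightarrow> ('v, 'a, 'k, 'u) rep set" where
  "reps k Q = {M.
     Space M \<in> (\<Pi>\<^sub>E i\<in>verts Q. {M. module k M}) \<and>
     Map M \<in> (\<Pi>\<^sub>E \<alpha>\<in>arcs Q. linear_maps k (Space M (tail Q \<alpha>)) (Space M (head Q \<alpha>)))}"

definition rep_homs ::
  "('k, 'x) ring_scheme \<Rightarrow> ('v, 'a) pre_digraph \<Rightarrow> ('v, 'a, 'k, 'u) rep \<Rightarrow> ('v, 'a, 'k, 'u) rep
    \<Rightarrow> ('v \<Rightarrow> 'u \<Rightarrow> 'u) set" where
  "rep_homs k Q M N = {f \<in> (\<Pi>\<^sub>E i\<in>verts Q. linear_maps k (Space M i) (Space N i)).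
     \<forall>\<alpha>\<in>arcs Q. \<forall>x\<in>carrier (Space M (tail Q \<alpha>)).
       f (head Q \<alpha>) (Map M \<alpha> x) = Map N \<alpha> (f (tail Q \<alpha>) x)}"

definition rep_cat ::
  "('k, 'x) ring_scheme \<Rightarrow> ('v, 'a) pre_digraph \<Rightarrow> (('v, 'a, 'k, 'u) rep, 'v \<Rightarrow> 'u \<Rightarrow> 'u) cat" where
  "rep_cat k Q = \<lparr>
     Obj = reps k Q,
     Arr = rep_homs k Q,
     Comp = (\<lambda>L M N g f. \<lambda>i\<in>verts Q. compose (carrier (Space L i)) (g i) (f i)),
     Ident = (\<lambda>M. \<lambda>i\<in>verts Q. \<lambda>x\<in>carrier (Space M i). x)\<rparr>"

section \<open>Birepresentations\<close>

type_synonym ('v, 'a, 'w, 'b, 'k, 'u) birep =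
  "('v, 'a, 'k, 'u) rep \<times> ('w, 'b, 'k, 'u) rep \<times> ('a \<times> 'b \<Rightarrow> 'u \<Rightarrow> 'u)"

definition bireps ::
  "('k, 'x) ring_scheme \<Rightarrow> ('v, 'a) pre_digraph \<Rightarrow> ('w, 'b) pre_digraph
    \<Rightarrow> ('v, 'a, 'w, 'b, 'k, 'u) birep set" where
  "bireps k Q Q' = {(V, V', \<psi>).
     V \<in> reps k Q \<and> V' \<in> reps k Q' \<and>
     \<psi> \<in> (\<Pi>\<^sub>E (\<alpha>, \<beta>)\<in>arcs Q \<times> arcs Q'. linear_maps k (Space V (head Q \<alpha>)) (Space V' (tail Q' \<beta>)))}"

definition birep_homs ::
  "('k, 'x) ring_scheme \<Rightarrow> ('v, 'a) pre_digraph \<Rightarrow> ('w, 'b) pre_digraph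
    \<Rightarrow> ('v, 'a, 'w, 'b, 'k, 'u) birep \<Rightarrow> ('v, 'a, 'w, 'b, 'k, 'u) birep
    \<Rightarrow> (('v \<Rightarrow> 'u \<Rightarrow> 'u) \<times> ('w \<Rightarrow> 'u \<Rightarrow> 'u)) set" where
  "birep_homs k Q Q' = (\<lambda>(V, V', \<psi>) (W, W', \<theta>). {(f, f').
     f \<in> rep_homs k Q V W \<and> f' \<in> rep_homs k Q' V' W' \<and>
     (\<forall>\<alpha>\<in>arcs Q. \<forall>\<beta>\<in>arcs Q'. \<forall>x\<in>carrier (Space V (head Q \<alpha>)).
        f' (tail Q' \<beta>) (\<psi> (\<alpha>, \<beta>) x) = \<theta> (\<alpha>, \<beta>) (f (head Q \<alpha>) x))})"

definition forget_obj ::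
  "('v, 'a, 'w, 'b, 'k, 'u) birep \<Rightarrow> ('v, 'a, 'k, 'u) rep \<times> ('w, 'b, 'k, 'u) rep" where
  "forget_obj = (\<lambda>(V, V', \<psi>). (V, V'))"

definition birep_cat ::
  "('k, 'x) ring_scheme \<Rightarrow> ('v, 'a) pre_digraph \<Rightarrow> ('w, 'b) pre_digraph
    \<Rightarrow> (('v, 'a, 'w, 'b, 'k, 'u) birep, ('v \<Rightarrow> 'u \<Rightarrow> 'u) \<times> ('w \<Rightarrow> 'u \<Rightarrow> 'u)) cat" where
  "birep_cat k Q Q' = \<lparr>
     Obj = bireps k Q Q',
     Arr = birep_homs k Q Q',
     Comp = (\<lambda>x y z. Comp (prod_cat (rep_cat k Q) (rep_cat k Q'))
               (forget_obj x) (forget_obj y) (forget_obj z)),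
     Ident = (\<lambda>x. Ident (prod_cat (rep_cat k Q) (rep_cat k Q')) (forget_obj x))\<rparr>"

definition forgetful ::
  "(('v, 'a, 'w, 'b, 'k, 'u) birep, ('v \<Rightarrow> 'u \<Rightarrow> 'u) \<times> ('w \<Rightarrow> 'u \<Rightarrow> 'u),
    ('v, 'a, 'k, 'u) rep \<times> ('w, 'b, 'k, 'u) rep, ('v \<Rightarrow> 'u \<Rightarrow> 'u) \<times> ('w \<Rightarrow> 'u \<Rightarrow> 'u)) fctr" where
  "forgetful = \<lparr>FObj = forget_obj, FArr = (\<lambda>x y f. f)\<rparr>"

end

theory Submission
  imports Defs
begin

text \<open>
  The idea is that limits of representations are computed vertex by vertex, so that a vector of
  the limit at a vertex \<open>i\<close> is the same as a compatible family of vectors at \<open>i\<close> in the diagram.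
  Once this is known for every limit, the maps \<open>\<psi>'\<close> of the limit birepresentation are forced: they
  apply the maps of the birepresentations in the diagram to compatible families, componentwise.
  The result is compatible again because the transition maps are morphisms of birepresentations,
  and linearity and the universal property can be tested after the jointly injective projections
  \<open>\<eta>' d\<close> (\<open>ex_birep_limit\<close>).

  An arbitrary limit \<open>L\<close> in the category of representations is given only by its universal
  property.  That it is nevertheless computed vertexwise follows from the existence of one limit
  with this property (\<open>ex_vertexwise_limit\<close>, \<open>is_limit_if_vertexwise\<close>) and the uniqueness of limits
  up to isomorphism (\<open>vertexwise_if_is_limit\<close>).  Smallness of the diagram enters in the existence
  part: compatible families are elements of a product, and must be encoded as elements of the
  universe (\<open>small_submodule_of_product\<close>).

  Completeness is then immediate.  The limits constructed in this way are preserved by the forgetful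
  functor, since pairs of limits are limits in a product category; by uniqueness of limits all limits
  are preserved (\<open>preserves_limit_if_preserves_one\<close>).
\<close>

section \<open>Limits in arbitrary categories\<close>

lemma is_functorI:
  assumes "category C" "category D"
    and "\<And>x. x \<in> Obj C \<Longrightarrow> FObj F x \<in> Obj D"
    and "\<And>x y f. \<lbrakk>x \<in> Obj C; y \<in> Obj C; f \<in> Arr C x y\<rbrakk>
        \<Longrightarrow> FArr F x y f \<in> Arr D (FObj F x) (FObj F y)"
    and "\<And>x. x \<in> Obj C \<Longrightarrow> FArr F x x (Ident C x) = Ident D (FObj F x)"
    and "\<And>x y z f g. \<lbrakk>x \<in> Obj C; y \<in> Obj C; z \<in> Obj C; f \<in> Arr C x y; g \<in> Arr C y z\<rbrakk>
        \<Longrightarrow> FArr F x z (Comp C x y z g f)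
            = Comp D (FObj F x) (FObj F y) (FObj F z) (FArr F y z g) (FArr F x y f)"
  shows "is_functor C D F"
  using assms by (auto simp: is_functor_def is_functor_axioms_def)

lemma is_functor_comp:
  assumes F: "is_functor B C F" and G: "is_functor C D G"
  shows "is_functor B D (G \<circ>\<^sub>F F)"
proof -
  interpret F: is_functor B C F by fact
  interpret G: is_functor C D G by fact
  show ?thesis
    by (rule is_functorI)
      (simp_all add: comp_fctr_def F.src.category_axioms G.trg.category_axioms
        F.obj_closed F.arr_closed F.pres_ident F.pres_comp
        G.obj_closed G.arr_closed G.pres_ident G.pres_comp)
qed

lemma category_prod_cat:
  assumes C: "category C" and D: "category D"
  shows "category (prod_cat C D)"
proof -
  interpret C: category C by fact
  interpret D: category D by fact
  show ?thesis
    by unfold_locales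
      (auto simp: prod_cat_def C.ident_closed D.ident_closed C.comp_ident_left C.comp_ident_right
        D.comp_ident_left D.comp_ident_right
        intro: C.comp_closed D.comp_closed C.comp_assoc D.comp_assoc)
qed

lemma is_functor_fst_fctr:
  assumes "category C" "category D"
  shows "is_functor (prod_cat C D) C fst_fctr"
  by (rule is_functorI[OF category_prod_cat[OF assms] assms(1)])
    (auto simp: fst_fctr_def prod_cat_def)

lemma is_functor_snd_fctr:
  assumes "category C" "category D"
  shows "is_functor (prod_cat C D) D snd_fctr"
  by (rule is_functorI[OF category_prod_cat[OF assms] assms(2)])
    (auto simp: snd_fctr_def prod_cat_def)

lemma is_limitD_ex1:
  assumes "is_limit D C F L \<eta>" "is_cone D C F M \<mu>"
  shows "\<exists>!h. h \<in> Arr C M L \<and> (\<forall>d\<in>Obj D. Comp C M L (FObj F d) (\<eta> d) h = \<mu> d)"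
  using assms unfolding is_limit_def by blast

lemma is_limitD_unique:
  assumes "is_limit D C F L \<eta>" "is_cone D C F M \<mu>"
    and "g \<in> Arr C M L" "\<And>d. d \<in> Obj D \<Longrightarrow> Comp C M L (FObj F d) (\<eta> d) g = \<mu> d"
    and "h \<in> Arr C M L" "\<And>d. d \<in> Obj D \<Longrightarrow> Comp C M L (FObj F d) (\<eta> d) h = \<mu> d"
  shows "g = h"
  using is_limitD_ex1[OF assms(1,2)] assms(3-) by blast

lemma is_limit_endo_ident:
  assumes C: "category C" and F: "is_functor D C F" and L: "is_limit D C F L \<eta>"
    and h: "h \<in> Arr C L L" "\<And>d. d \<in> Obj D \<Longrightarrow> Comp C L L (FObj F d) (\<eta> d) h = \<eta> d"
  shows "h = Ident C L"
proof -
  interpret C: category C by fact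
  interpret F: is_functor D C F by fact
  have cone: "is_cone D C F L \<eta>"
    using L by (simp add: is_limit_def)
  then have LO: "L \<in> Obj C" and "\<And>d. d \<in> Obj D \<Longrightarrow> \<eta> d \<in> Arr C L (FObj F d)"
    by (auto simp: is_cone_def)
  then show ?thesis
    using is_limitD_unique[OF L cone h, of "Ident C L"]
    by (simp add: C.ident_closed C.comp_ident_right F.obj_closed)
qed

text \<open>
  Uniqueness of limits up to isomorphism: each mediating arrow is inverse to the other, because
  their composites mediate a limiting cone to itself.
\<close>

lemma is_limit_iso:
  assumes C: "category C" and F: "is_functor D C F"
    and L: "is_limit D C F L \<eta>" and M: "is_limit D C F M \<mu>"
  obtains g h where "g \<in> Arr C M L" "h \<in> Arr C L M"
    "Comp C L M L g h = Ident C L" "Comp C M L M h g = Ident C M"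
    "\<And>d. d \<in> Obj D \<Longrightarrow> Comp C M L (FObj F d) (\<eta> d) g = \<mu> d"
    "\<And>d. d \<in> Obj D \<Longrightarrow> Comp C L M (FObj F d) (\<mu> d) h = \<eta> d"
proof -
  interpret C: category C by fact
  interpret F: is_functor D C F by fact
  have cones: "is_cone D C F L \<eta>" "is_cone D C F M \<mu>"
    using L M by (auto simp: is_limit_def)
  then have O: "L \<in> Obj C" "M \<in> Obj C"
    and arr: "\<And>d. d \<in> Obj D \<Longrightarrow> \<eta> d \<in> Arr C L (FObj F d)"
      "\<And>d. d \<in> Obj D \<Longrightarrow> \<mu> d \<in> Arr C M (FObj F d)"
    by (auto simp: is_cone_def)
  obtain g where g: "g \<in> Arr C M L" "\<And>d. d \<in> Obj D \<Longrightarrow> Comp C M L (FObj F d) (\<eta> d) g = \<mu> d"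
    using is_limitD_ex1[OF L cones(2)] by blast
  obtain h where h: "h \<in> Arr C L M" "\<And>d. d \<in> Obj D \<Longrightarrow> Comp C L M (FObj F d) (\<mu> d) h = \<eta> d"
    using is_limitD_ex1[OF M cones(1)] by blast
  have gh: "Comp C L M L g h = Ident C L"
  proof (rule is_limit_endo_ident[OF C F L])
    show "Comp C L M L g h \<in> Arr C L L"
      using O g(1) h(1) by (blast intro: C.comp_closed)
    show "Comp C L L (FObj F d) (\<eta> d) (Comp C L M L g h) = \<eta> d" if "d \<in> Obj D" for d
      using C.comp_assoc[OF O(1,2,1) F.obj_closed[OF that] h(1) g(1) arr(1)[OF that]] g h that
      by simp
  qed
  have hg: "Comp C M L M h g = Ident C M"
  proof (rule is_limit_endo_ident[OF C F M])
    show "Comp C M L M h g \<in> Arr C M M"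
      using O g(1) h(1) by (blast intro: C.comp_closed)
    show "Comp C M M (FObj F d) (\<mu> d) (Comp C M L M h g) = \<mu> d" if "d \<in> Obj D" for d
      using C.comp_assoc[OF O(2,1,2) F.obj_closed[OF that] g(1) h(1) arr(2)[OF that]] g h that
      by simp
  qed
  show thesis
    by (rule that[OF g(1) h(1) gh hg g(2) h(2)])
qed

text \<open>
  The arrow mediating a cone to \<open>M\<close> is the one mediating it to \<open>L\<close> followed by the inverse \<open>h\<close>.
\<close>

lemma is_limit_transport:
  assumes C: "category C" and F: "is_functor D C F" and L: "is_limit D C F L \<eta>"
    and M: "M \<in> Obj C" and gh: "g \<in> Arr C M L" "h \<in> Arr C L M"
    "Comp C L M L g h = Ident C L" "Comp C M L M h g = Ident C M"
    and \<mu>: "\<And>d. d \<in> Obj D \<Longrightarrow> \<mu> d = Comp C M L (FObj F d) (\<eta> d) g"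
  shows "is_limit D C F M \<mu>"
proof -
  interpret C: category C by fact
  interpret F: is_functor D C F by fact
  have "is_cone D C F L \<eta>"
    using L by (auto simp: is_limit_def)
  then have LO: "L \<in> Obj C" and \<eta>: "\<And>d. d \<in> Obj D \<Longrightarrow> \<eta> d \<in> Arr C L (FObj F d)"
    and nat: "\<And>d d' f. \<lbrakk>d \<in> Obj D; d' \<in> Obj D; f \<in> Arr D d d'\<rbrakk> \<Longrightarrow>
      Comp C L (FObj F d) (FObj F d') (FArr F d d' f) (\<eta> d) = \<eta> d'"
    by (auto simp: is_cone_def)
  have \<mu>_arr: "\<mu> d \<in> Arr C M (FObj F d)" if "d \<in> Obj D" for d
    using that by (simp add: \<mu>) (meson C.comp_closed F.obj_closed LO M \<eta> gh(1))
  have \<mu>h: "Comp C L M (FObj F d) (\<mu> d) h = \<eta> d" if "d \<in> Obj D" for d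
    using C.comp_assoc[OF LO M LO F.obj_closed gh(2,1) \<eta>] that
    by (simp add: \<mu> gh C.comp_ident_right LO F.obj_closed \<eta>)
  have "is_cone D C F M \<mu>"
    unfolding is_cone_def
  proof (intro conjI ballI M \<mu>_arr)
    fix d d' f assume d: "d \<in> Obj D" "d' \<in> Obj D" and f: "f \<in> Arr D d d'"
    show "Comp C M (FObj F d) (FObj F d') (FArr F d d' f) (\<mu> d) = \<mu> d'"
      using C.comp_assoc[OF M LO F.obj_closed F.obj_closed gh(1) \<eta> F.arr_closed] nat d f
      by (simp add: \<mu>)
  qed
  moreover
  have "\<exists>!u. u \<in> Arr C N M \<and> (\<forall>d\<in>Obj D. Comp C N M (FObj F d) (\<mu> d) u = \<nu> d)"
    if N: "is_cone D C F N \<nu>" for N \<nu>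
  proof -
    have NO: "N \<in> Obj C"
      using N by (simp add: is_cone_def)
    obtain v where v: "v \<in> Arr C N L" "\<And>d. d \<in> Obj D \<Longrightarrow> Comp C N L (FObj F d) (\<eta> d) v = \<nu> d"
      using is_limitD_ex1[OF L N] by blast
    show ?thesis
    proof (rule ex1I[of _ "Comp C N L M h v"])
      show "Comp C N L M h v \<in> Arr C N M \<and>
          (\<forall>d\<in>Obj D. Comp C N M (FObj F d) (\<mu> d) (Comp C N L M h v) = \<nu> d)"
        using C.comp_assoc[OF NO LO M F.obj_closed v(1) gh(2) \<mu>_arr] v(2)
        by (auto simp: \<mu>h intro: C.comp_closed[OF NO LO M v(1) gh(2)])
      fix u assume u: "u \<in> Arr C N M \<and> (\<forall>d\<in>Obj D. Comp C N M (FObj F d) (\<mu> d) u = \<nu> d)"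
      have "Comp C N M L g u = v"
      proof (rule is_limitD_unique[OF L N _ _ v])
        show "Comp C N M L g u \<in> Arr C N L"
          using u by (blast intro: C.comp_closed NO M LO gh)
        show "Comp C N L (FObj F d) (\<eta> d) (Comp C N M L g u) = \<nu> d" if "d \<in> Obj D" for d
          using C.comp_assoc[OF NO M LO F.obj_closed _ gh(1) \<eta>, of d u] u that by (simp add: \<mu>)
      qed
      then show "u = Comp C N L M h v"
        using C.comp_assoc[OF NO M LO M _ gh(1,2), of u] u
        by (simp add: gh C.comp_ident_left NO M)
    qed
  qed
  ultimately show ?thesis
    unfolding is_limit_def by blast
qed

text \<open>
  Functors preserve isomorphisms and limits are unique up to isomorphism; hence it suffices to see
  one limit of a diagram preserved.
\<close>

lemma preserves_limit_if_preserves_one: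
  assumes C: "category C" and F: "is_functor D C F" and G: "is_functor C C' G"
    and L: "is_limit D C F L \<eta>" and M: "is_limit D C F M \<mu>"
    and GL: "is_limit D C' (G \<circ>\<^sub>F F) (FObj G L) (\<lambda>d. FArr G L (FObj F d) (\<eta> d))"
  shows "is_limit D C' (G \<circ>\<^sub>F F) (FObj G M) (\<lambda>d. FArr G M (FObj F d) (\<mu> d))"
proof -
  interpret F: is_functor D C F by fact
  interpret G: is_functor C C' G by fact
  obtain g h where gh: "g \<in> Arr C M L" "h \<in> Arr C L M"
    "Comp C L M L g h = Ident C L" "Comp C M L M h g = Ident C M"
    "\<And>d. d \<in> Obj D \<Longrightarrow> Comp C M L (FObj F d) (\<eta> d) g = \<mu> d"
    using is_limit_iso[OF C F L M] by metis
  have O: "L \<in> Obj C" "M \<in> Obj C" and \<eta>: "\<And>d. d \<in> Obj D \<Longrightarrow> \<eta> d \<in> Arr C L (FObj F d)"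
    using L M by (auto simp: is_limit_def is_cone_def)
  show ?thesis
  proof (rule is_limit_transport[OF G.trg.category_axioms is_functor_comp[OF F G] GL,
        where g = "FArr G M L g" and h = "FArr G L M h"])
    show "Comp C' (FObj G L) (FObj G M) (FObj G L) (FArr G M L g) (FArr G L M h)
        = Ident C' (FObj G L)"
      using G.pres_comp[OF O(1,2,1) gh(2,1)] by (simp add: gh G.pres_ident O)
    show "Comp C' (FObj G M) (FObj G L) (FObj G M) (FArr G L M h) (FArr G M L g)
        = Ident C' (FObj G M)"
      using G.pres_comp[OF O(2,1,2) gh(1,2)] by (simp add: gh G.pres_ident O)
    show "FArr G M (FObj F d) (\<mu> d) = Comp C' (FObj G M) (FObj G L) (FObj (G \<circ>\<^sub>F F) d)
        (FArr G L (FObj F d) (\<eta> d)) (FArr G M L g)" if "d \<in> Obj D" for d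
      using G.pres_comp[OF O(2,1) F.obj_closed gh(1) \<eta>] gh(5) that by (simp add: comp_fctr_def)
  qed (auto simp: O gh intro: G.obj_closed G.arr_closed)
qed

lemma is_cone_prod_cat_iff:
  "is_cone D (prod_cat C C') F M \<mu> \<longleftrightarrow>
    is_cone D C (fst_fctr \<circ>\<^sub>F F) (fst M) (\<lambda>d. fst (\<mu> d)) \<and>
    is_cone D C' (snd_fctr \<circ>\<^sub>F F) (snd M) (\<lambda>d. snd (\<mu> d))"
  unfolding is_cone_def prod_cat_def comp_fctr_def fst_fctr_def snd_fctr_def
  by (auto simp: mem_Times_iff prod_eq_iff)

lemma ex1_pair:
  assumes "\<exists>!x. P x" "\<exists>!y. P' y"
  shows "\<exists>!z. P (fst z) \<and> P' (snd z)"
  using assms by (metis fst_conv prod.expand snd_conv)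

lemma is_limit_prod_cat:
  assumes L: "is_limit D C (fst_fctr \<circ>\<^sub>F F) L \<eta>" and L': "is_limit D C' (snd_fctr \<circ>\<^sub>F F) L' \<eta>'"
  shows "is_limit D (prod_cat C C') F (L, L') (\<lambda>d. (\<eta> d, \<eta>' d))"
  unfolding is_limit_def
proof (intro conjI allI impI)
  show "is_cone D (prod_cat C C') F (L, L') (\<lambda>d. (\<eta> d, \<eta>' d))"
    using assms by (simp add: is_cone_prod_cat_iff is_limit_def)
next
  fix M \<mu> assume "is_cone D (prod_cat C C') F M \<mu>"
  then have M: "is_cone D C (fst_fctr \<circ>\<^sub>F F) (fst M) (\<lambda>d. fst (\<mu> d))"
    "is_cone D C' (snd_fctr \<circ>\<^sub>F F) (snd M) (\<lambda>d. snd (\<mu> d))"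
    by (simp_all add: is_cone_prod_cat_iff)
  let ?P = "\<lambda>h. h \<in> Arr C (fst M) L \<and>
    (\<forall>d\<in>Obj D. Comp C (fst M) L (FObj (fst_fctr \<circ>\<^sub>F F) d) (\<eta> d) h = fst (\<mu> d))"
  let ?P' = "\<lambda>h. h \<in> Arr C' (snd M) L' \<and>
    (\<forall>d\<in>Obj D. Comp C' (snd M) L' (FObj (snd_fctr \<circ>\<^sub>F F) d) (\<eta>' d) h = snd (\<mu> d))"
  have "\<exists>!h. ?P (fst h) \<and> ?P' (snd h)"
    using is_limitD_ex1[OF L M(1)] is_limitD_ex1[OF L' M(2)]
    by (rule ex1_pair)
  then show "\<exists>!h. h \<in> Arr (prod_cat C C') M (L, L') \<and>
      (\<forall>d\<in>Obj D. Comp (prod_cat C C') M (L, L') (FObj F d) (\<eta> d, \<eta>' d) h = \<mu> d)"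
    by (rule back_subst[where P = Ex1])
      (auto simp: fun_eq_iff prod_cat_def comp_fctr_def fst_fctr_def snd_fctr_def
        mem_Times_iff prod_eq_iff)
qed

section \<open>Linear maps and limits of modules\<close>

lemma linear_mapsD:
  assumes "f \<in> linear_maps k M N"
  shows "x \<in> carrier M \<Longrightarrow> f x \<in> carrier N"
    and "\<lbrakk>x \<in> carrier M; y \<in> carrier M\<rbrakk> \<Longrightarrow> f (x \<oplus>\<^bsub>M\<^esub> y) = f x \<oplus>\<^bsub>N\<^esub> f y"
    and "\<lbrakk>c \<in> carrier k; x \<in> carrier M\<rbrakk> \<Longrightarrow> f (c \<odot>\<^bsub>M\<^esub> x) = c \<odot>\<^bsub>N\<^esub> f x"
    and "f \<in> extensional (carrier M)"
  using assms by (auto simp: linear_maps_def PiE_def)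

lemma linear_maps_eqI:
  assumes "f \<in> linear_maps k M N" "g \<in> linear_maps k M N'"
    and "\<And>x. x \<in> carrier M \<Longrightarrow> f x = g x"
  shows "f = g"
  using assms by (meson extensionalityI linear_mapsD(4))

lemma linear_maps_zero:
  assumes "module k M" "module k N" "f \<in> linear_maps k M N"
  shows "f \<zero>\<^bsub>M\<^esub> = \<zero>\<^bsub>N\<^esub>"
proof -
  interpret M: module k M by fact
  interpret N: module k N by fact
  have "f (\<zero>\<^bsub>k\<^esub> \<odot>\<^bsub>M\<^esub> \<zero>\<^bsub>M\<^esub>) = \<zero>\<^bsub>k\<^esub> \<odot>\<^bsub>N\<^esub> f \<zero>\<^bsub>M\<^esub>"
    by (intro linear_mapsD(3)[OF assms(3)]) auto
  then show ?thesis
    using linear_mapsD(1)[OF assms(3)] by simp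
qed

lemma linear_maps_compose:
  assumes "module k L" and f: "f \<in> linear_maps k L M" and g: "g \<in> linear_maps k M N"
  shows "compose (carrier L) g f \<in> linear_maps k L N"
proof -
  interpret L: module k L by fact
  show ?thesis
    using linear_mapsD[OF f] linear_mapsD[OF g]
    by (auto simp: linear_maps_def compose_def)
qed

lemma linear_maps_ident:
  assumes "module k M"
  shows "(\<lambda>x\<in>carrier M. x) \<in> linear_maps k M M"
proof -
  interpret M: module k M by fact
  show ?thesis
    by (auto simp: linear_maps_def)
qed

definition tuple :: "'i set \<Rightarrow> ('i \<Rightarrow> 'a \<Rightarrow> 'b) \<Rightarrow> 'a \<Rightarrow> 'i \<Rightarrow> 'b" where
  "tuple I f x = (\<lambda>i\<in>I. f i x)"

lemma tuple_eq_iff: "tuple I f x = tuple I g y \<longleftrightarrow> (\<forall>i\<in>I. f i x = g i y)"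
proof
  assume eq: "tuple I f x = tuple I g y"
  show "\<forall>i\<in>I. f i x = g i y"
  proof
    fix i assume "i \<in> I"
    then show "f i x = g i y"
      using fun_cong[OF eq, of i] by (simp add: tuple_def)
  qed
qed (simp add: tuple_def cong: restrict_cong)

text \<open>
  The universal property of a limit module with its projections \<open>pr\<close>, for tuples of linear maps
  into the factors.  Linearity of the lift is automatic, because it can be tested after the
  jointly injective linear maps \<open>pr\<close>.
\<close>

lemma linear_lift:
  assumes "module k L" "module k M"
    and pr: "\<And>i. i \<in> I \<Longrightarrow> pr i \<in> linear_maps k L (N i)"
    and bij: "bij_betw (tuple I pr) (carrier L) S"
    and g: "\<And>i. i \<in> I \<Longrightarrow> g i \<in> linear_maps k M (N i)"
    and S: "\<And>x. x \<in> carrier M \<Longrightarrow> tuple I g x \<in> S"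
  shows "\<exists>h\<in>linear_maps k M L. \<forall>i\<in>I. \<forall>x\<in>carrier M. pr i (h x) = g i x"
proof -
  interpret L: module k L by fact
  interpret M: module k M by fact
  define h where "h = (\<lambda>x\<in>carrier M. inv_into (carrier L) (tuple I pr) (tuple I g x))"
  have img: "tuple I pr ` carrier L = S"
    using bij by (simp add: bij_betw_def)
  have h_closed: "h x \<in> carrier L" if "x \<in> carrier M" for x
    using that S img by (simp add: h_def inv_into_into)
  have "tuple I pr (h x) = tuple I g x" if "x \<in> carrier M" for x
    using that S img by (simp add: h_def f_inv_into_f)
  then have prh: "pr i (h x) = g i x" if "i \<in> I" "x \<in> carrier M" for i x
    using that by (simp add: tuple_eq_iff)
  have inj: "x = y" if "x \<in> carrier L" "y \<in> carrier L" "\<And>i. i \<in> I \<Longrightarrow> pr i x = pr i y" for x y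
    using that inj_onD[OF bij_betw_imp_inj_on[OF bij]] by (simp add: tuple_eq_iff)
  have "h (x \<oplus>\<^bsub>M\<^esub> y) = h x \<oplus>\<^bsub>L\<^esub> h y" if "x \<in> carrier M" "y \<in> carrier M" for x y
    using that linear_mapsD(2)[OF pr] linear_mapsD(2)[OF g]
    by - (rule inj, simp_all add: h_closed prh)
  moreover have "h (c \<odot>\<^bsub>M\<^esub> x) = c \<odot>\<^bsub>L\<^esub> h x" if "c \<in> carrier k" "x \<in> carrier M" for c x
    using that linear_mapsD(3)[OF pr] linear_mapsD(3)[OF g]
    by - (rule inj, simp_all add: h_closed prh)
  moreover have "h \<in> carrier M \<rightarrow>\<^sub>E carrier L"
    using h_closed by (auto simp: h_def)
  ultimately have "h \<in> linear_maps k M L"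
    by (auto simp: linear_maps_def)
  with prh show ?thesis
    by blast
qed

text \<open>
  Smallness of the index set is exactly what lets a submodule of the product, whose elements are
  families, be encoded by an injection as a module with elements in the universe \<open>'u\<close>.
\<close>

lemma small_submodule_of_product:
  fixes N :: "'i \<Rightarrow> ('k, 'u) module"
  assumes k: "cring k" and small: "small TYPE('u) I"
    and N: "\<And>i. i \<in> I \<Longrightarrow> module k (N i)"
    and S: "S \<subseteq> (\<Pi>\<^sub>E i\<in>I. carrier (N i))"
    and zero: "(\<lambda>i\<in>I. \<zero>\<^bsub>N i\<^esub>) \<in> S"
    and add: "\<And>x y. \<lbrakk>x \<in> S; y \<in> S\<rbrakk> \<Longrightarrow> (\<lambda>i\<in>I. x i \<oplus>\<^bsub>N i\<^esub> y i) \<in> S"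
    and smult: "\<And>c x. \<lbrakk>c \<in> carrier k; x \<in> S\<rbrakk> \<Longrightarrow> (\<lambda>i\<in>I. c \<odot>\<^bsub>N i\<^esub> x i) \<in> S"
  shows "\<exists>(L :: ('k, 'u) module) pr. module k L \<and>
    (\<forall>i\<in>I. pr i \<in> linear_maps k L (N i)) \<and> bij_betw (tuple I pr) (carrier L) S"
proof -
  obtain e :: "('i \<Rightarrow> 'u) \<Rightarrow> 'u" where e: "inj_on e (I \<rightarrow>\<^sub>E UNIV)"
    using small by (auto simp: small_def lepoll_def)
  have inj: "inj_on e S"
    by (rule inj_on_subset[OF e]) (use S in \<open>auto simp: PiE_iff\<close>)
  define dec where "dec u = inv_into S e u" for u
  have dec_e: "dec (e x) = x" if "x \<in> S" for x
    using inj that by (simp add: dec_def)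
  define L :: "('k, 'u) module" where "L = \<lparr>carrier = e ` S, monoid.mult = undefined, monoid.one = undefined,
     zero = e (\<lambda>i\<in>I. \<zero>\<^bsub>N i\<^esub>), add = (\<lambda>u v. e (\<lambda>i\<in>I. dec u i \<oplus>\<^bsub>N i\<^esub> dec v i)),
     smult = (\<lambda>c u. e (\<lambda>i\<in>I. c \<odot>\<^bsub>N i\<^esub> dec u i))\<rparr>"
  have L: "carrier L = e ` S" "\<zero>\<^bsub>L\<^esub> = e (\<lambda>i\<in>I. \<zero>\<^bsub>N i\<^esub>)"
    "\<And>x y. \<lbrakk>x \<in> S; y \<in> S\<rbrakk> \<Longrightarrow> e x \<oplus>\<^bsub>L\<^esub> e y = e (\<lambda>i\<in>I. x i \<oplus>\<^bsub>N i\<^esub> y i)"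
    "\<And>c x. x \<in> S \<Longrightarrow> c \<odot>\<^bsub>L\<^esub> e x = e (\<lambda>i\<in>I. c \<odot>\<^bsub>N i\<^esub> x i)"
    by (simp_all add: L_def dec_e cong: restrict_cong)
  have SN: "x i \<in> carrier (N i)" if "x \<in> S" "i \<in> I" for x i
    using S that by (auto simp: PiE_iff)
  have S_ext: "restrict x I = x" if "x \<in> S" for x
    using S that by (auto simp: PiE_iff extensional_restrict)
  interpret k: cring k by fact
  have ag: "abelian_group (N i)" if "i \<in> I" for i
    using N[OF that] by (simp add: module_def)
  have minus: "(\<ominus>\<^bsub>k\<^esub> \<one>\<^bsub>k\<^esub>) \<odot>\<^bsub>N i\<^esub> x \<oplus>\<^bsub>N i\<^esub> x = \<zero>\<^bsub>N i\<^esub>"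
    if "i \<in> I" "x \<in> carrier (N i)" for i x
  proof -
    interpret N: module k "N i" by (rule N[OF that(1)])
    show ?thesis
      using that(2) by (simp add: N.smult_l_minus N.M.l_neg)
  qed
  have "abelian_group L"
  proof (rule abelian_groupI)
    fix u assume "u \<in> carrier L"
    then obtain x where x: "x \<in> S" "u = e x"
      by (auto simp: L)
    \<comment> \<open>Additive inverses come from multiplication by the scalar \<open>-1\<close>.\<close>
    let ?y = "\<lambda>i\<in>I. (\<ominus>\<^bsub>k\<^esub> \<one>\<^bsub>k\<^esub>) \<odot>\<^bsub>N i\<^esub> x i"
    have y: "?y \<in> S"
      using x by (intro smult) auto
    have "e ?y \<oplus>\<^bsub>L\<^esub> u = \<zero>\<^bsub>L\<^esub>"
      using x y by (auto simp: L minus SN cong: restrict_cong)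
    then show "\<exists>v\<in>carrier L. v \<oplus>\<^bsub>L\<^esub> u = \<zero>\<^bsub>L\<^esub>"
      using y by (auto simp: L(1))
  next
    fix u v assume "u \<in> carrier L" "v \<in> carrier L"
    then show "u \<oplus>\<^bsub>L\<^esub> v = v \<oplus>\<^bsub>L\<^esub> u"
      by (auto simp: L SN abelian_groupE(4)[OF ag] cong: restrict_cong)
  qed (auto simp: L zero add SN S_ext abelian_groupE(3,5)[OF ag] cong: restrict_cong)
  then have "module k L"
  proof (intro moduleI k)
    show "c \<odot>\<^bsub>L\<^esub> u \<in> carrier L" if "c \<in> carrier k" "u \<in> carrier L" for c u
      using that by (auto simp: L smult)
    show "(a \<oplus>\<^bsub>k\<^esub> b) \<odot>\<^bsub>L\<^esub> u = a \<odot>\<^bsub>L\<^esub> u \<oplus>\<^bsub>L\<^esub> b \<odot>\<^bsub>L\<^esub> u"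
      if "a \<in> carrier k" "b \<in> carrier k" "u \<in> carrier L" for a b u
      using that by (auto simp: L smult SN module.smult_l_distr[OF N] cong: restrict_cong)
    show "a \<odot>\<^bsub>L\<^esub> (u \<oplus>\<^bsub>L\<^esub> v) = a \<odot>\<^bsub>L\<^esub> u \<oplus>\<^bsub>L\<^esub> a \<odot>\<^bsub>L\<^esub> v"
      if "a \<in> carrier k" "u \<in> carrier L" "v \<in> carrier L" for a u v
      using that by (auto simp: L smult add SN module.smult_r_distr[OF N] cong: restrict_cong)
    show "(a \<otimes>\<^bsub>k\<^esub> b) \<odot>\<^bsub>L\<^esub> u = a \<odot>\<^bsub>L\<^esub> (b \<odot>\<^bsub>L\<^esub> u)"
      if "a \<in> carrier k" "b \<in> carrier k" "u \<in> carrier L" for a b u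
      using that by (auto simp: L smult SN module.smult_assoc1[OF N] cong: restrict_cong)
    show "\<one>\<^bsub>k\<^esub> \<odot>\<^bsub>L\<^esub> u = u" if "u \<in> carrier L" for u
      using that by (auto simp: L SN S_ext module.smult_one[OF N] cong: restrict_cong)
  qed
  moreover define pr where "pr i = (\<lambda>u\<in>carrier L. dec u i)" for i
  have pr_e: "pr i (e x) = x i" if "x \<in> S" for x i
    using that by (simp add: pr_def L dec_e)
  have "pr i \<in> linear_maps k L (N i)" if "i \<in> I" for i
  proof -
    have "pr i \<in> carrier L \<rightarrow>\<^sub>E carrier (N i)"
      using that by (auto simp: pr_def L dec_e SN)
    then show ?thesis
      using that by (auto simp: linear_maps_def L pr_e add smult)
  qed
  moreover have "bij_betw (tuple I pr) (carrier L) S"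
    by (rule bij_betw_byWitness[where f' = e])
      (auto simp: L tuple_def pr_e S_ext)
  ultimately show ?thesis
    by blast
qed

section \<open>Limits of representations of a quiver\<close>

lemma rep_cat_simps:
  "Obj (rep_cat k Q) = reps k Q"
  "Arr (rep_cat k Q) = rep_homs k Q"
  "Comp (rep_cat k Q) L M N g f = (\<lambda>i\<in>verts Q. compose (carrier (Space L i)) (g i) (f i))"
  "Ident (rep_cat k Q) M = (\<lambda>i\<in>verts Q. \<lambda>x\<in>carrier (Space M i). x)"
  by (simp_all add: rep_cat_def)

lemma repsD:
  assumes "M \<in> reps k Q"
  shows "i \<in> verts Q \<Longrightarrow> module k (Space M i)"
    and "\<alpha> \<in> arcs Q \<Longrightarrow> Map M \<alpha> \<in> linear_maps k (Space M (tail Q \<alpha>)) (Space M (head Q \<alpha>))"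
  using assms by (auto simp: reps_def PiE_iff)

lemma rep_homsD:
  assumes "f \<in> rep_homs k Q M N"
  shows "i \<in> verts Q \<Longrightarrow> f i \<in> linear_maps k (Space M i) (Space N i)"
    and "\<lbrakk>\<alpha> \<in> arcs Q; x \<in> carrier (Space M (tail Q \<alpha>))\<rbrakk>
      \<Longrightarrow> f (head Q \<alpha>) (Map M \<alpha> x) = Map N \<alpha> (f (tail Q \<alpha>) x)"
    and "f \<in> extensional (verts Q)"
  using assms by (auto simp: rep_homs_def PiE_iff)

lemma rep_homsI:
  assumes "\<And>i. i \<in> verts Q \<Longrightarrow> f i \<in> linear_maps k (Space M i) (Space N i)"
    and "\<And>\<alpha> x. \<lbrakk>\<alpha> \<in> arcs Q; x \<in> carrier (Space M (tail Q \<alpha>))\<rbrakk>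
      \<Longrightarrow> f (head Q \<alpha>) (Map M \<alpha> x) = Map N \<alpha> (f (tail Q \<alpha>) x)"
    and "f \<in> extensional (verts Q)"
  shows "f \<in> rep_homs k Q M N"
  using assms by (auto simp: rep_homs_def PiE_iff)

lemma rep_homs_apply_closed:
  "\<lbrakk>f \<in> rep_homs k Q M N; i \<in> verts Q; x \<in> carrier (Space M i)\<rbrakk> \<Longrightarrow> f i x \<in> carrier (Space N i)"
  using linear_mapsD(1) rep_homsD(1) by metis

lemma rep_homs_eqI:
  assumes f: "f \<in> rep_homs k Q M N" and g: "g \<in> rep_homs k Q M N'"
    and eq: "\<And>i x. \<lbrakk>i \<in> verts Q; x \<in> carrier (Space M i)\<rbrakk> \<Longrightarrow> f i x = g i x"
  shows "f = g"
  using rep_homsD(3)[OF f] rep_homsD(3)[OF g]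
proof (rule extensionalityI)
  show "f i = g i" if "i \<in> verts Q" for i
    using linear_maps_eqI[OF rep_homsD(1)[OF f that] rep_homsD(1)[OF g that]] eq[OF that] by blast
qed

lemma rep_comp_apply:
  "\<lbrakk>i \<in> verts Q; x \<in> carrier (Space L i)\<rbrakk> \<Longrightarrow> Comp (rep_cat k Q) L M N g f i x = g i (f i x)"
  by (simp add: rep_cat_simps compose_def)

lemma rep_homs_comp_closed:
  assumes Q: "wf_digraph Q" and L: "L \<in> reps k Q"
    and f: "f \<in> rep_homs k Q L M" and g: "g \<in> rep_homs k Q M N"
  shows "Comp (rep_cat k Q) L M N g f \<in> rep_homs k Q L N"
proof (rule rep_homsI)
  fix i assume i: "i \<in> verts Q"
  show "Comp (rep_cat k Q) L M N g f i \<in> linear_maps k (Space L i) (Space N i)"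
    using linear_maps_compose[OF repsD(1)[OF L i] rep_homsD(1)[OF f i] rep_homsD(1)[OF g i]] i
    by (simp add: rep_cat_simps)
next
  fix \<alpha> x assume \<alpha>: "\<alpha> \<in> arcs Q" and x: "x \<in> carrier (Space L (tail Q \<alpha>))"
  have v: "tail Q \<alpha> \<in> verts Q" "head Q \<alpha> \<in> verts Q"
    using Q \<alpha> by (simp_all add: wf_digraph_def)
  show "Comp (rep_cat k Q) L M N g f (head Q \<alpha>) (Map L \<alpha> x)
      = Map N \<alpha> (Comp (rep_cat k Q) L M N g f (tail Q \<alpha>) x)"
    using linear_mapsD(1)[OF repsD(2)[OF L \<alpha>] x] rep_homs_apply_closed[OF f v(1) x]
    by (simp add: rep_comp_apply v x rep_homsD(2)[OF f \<alpha>] rep_homsD(2)[OF g \<alpha>])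
qed (simp add: rep_cat_simps)

lemma rep_homs_ident:
  assumes Q: "wf_digraph Q" and M: "M \<in> reps k Q"
  shows "Ident (rep_cat k Q) M \<in> rep_homs k Q M M"
proof (rule rep_homsI)
  fix \<alpha> x assume \<alpha>: "\<alpha> \<in> arcs Q" and x: "x \<in> carrier (Space M (tail Q \<alpha>))"
  then show "Ident (rep_cat k Q) M (head Q \<alpha>) (Map M \<alpha> x)
      = Map M \<alpha> (Ident (rep_cat k Q) M (tail Q \<alpha>) x)"
    using Q linear_mapsD(1)[OF repsD(2)[OF M \<alpha>] x] by (simp add: rep_cat_simps wf_digraph_def)
qed (simp_all add: rep_cat_simps linear_maps_ident repsD(1)[OF M])

lemma category_rep_cat:
  assumes Q: "wf_digraph Q"
  shows "category (rep_cat k Q)"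
proof
  fix L M N f g
  assume "L \<in> Obj (rep_cat k Q)" "M \<in> Obj (rep_cat k Q)" "N \<in> Obj (rep_cat k Q)"
    "f \<in> Arr (rep_cat k Q) L M" "g \<in> Arr (rep_cat k Q) M N"
  then show "Comp (rep_cat k Q) L M N g f \<in> Arr (rep_cat k Q) L N"
    using rep_homs_comp_closed[OF Q] by (simp add: rep_cat_simps(1,2))
next
  fix M assume "M \<in> Obj (rep_cat k Q)"
  then show "Ident (rep_cat k Q) M \<in> Arr (rep_cat k Q) M M"
    using rep_homs_ident[OF Q] by (simp add: rep_cat_simps(1,2))
next
  fix L M f
  assume "L \<in> Obj (rep_cat k Q)" "M \<in> Obj (rep_cat k Q)" and "f \<in> Arr (rep_cat k Q) L M"
  then have L: "L \<in> reps k Q" and M: "M \<in> reps k Q" and f: "f \<in> rep_homs k Q L M"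
    by (simp_all add: rep_cat_simps)
  show "Comp (rep_cat k Q) L L M f (Ident (rep_cat k Q) L) = f"
    by (rule rep_homs_eqI[OF rep_homs_comp_closed[OF Q L rep_homs_ident[OF Q L] f] f])
      (simp add: rep_comp_apply, simp add: rep_cat_simps)
  show "Comp (rep_cat k Q) L M M (Ident (rep_cat k Q) M) f = f"
    by (rule rep_homs_eqI[OF rep_homs_comp_closed[OF Q L f rep_homs_ident[OF Q M]] f])
      (simp add: rep_comp_apply, simp add: rep_cat_simps rep_homs_apply_closed[OF f])
next
  fix K L M N f g h
  assume "K \<in> Obj (rep_cat k Q)" "L \<in> Obj (rep_cat k Q)" "M \<in> Obj (rep_cat k Q)"
    "N \<in> Obj (rep_cat k Q)" "f \<in> Arr (rep_cat k Q) K L" "g \<in> Arr (rep_cat k Q) L M"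
    "h \<in> Arr (rep_cat k Q) M N"
  then have f: "f \<in> rep_homs k Q K L"
    by (simp add: rep_cat_simps)
  show "Comp (rep_cat k Q) K M N h (Comp (rep_cat k Q) K L M g f)
      = Comp (rep_cat k Q) K L N (Comp (rep_cat k Q) L M N h g) f"
    by (simp add: rep_cat_simps compose_def rep_homs_apply_closed[OF f] cong: restrict_cong)
qed

definition compatible_families ::
  "('d, 'e) cat \<Rightarrow> ('d, 'e, ('v, 'a, 'k, 'u) rep, 'v \<Rightarrow> 'u \<Rightarrow> 'u) fctr \<Rightarrow> 'v \<Rightarrow> ('d \<Rightarrow> 'u) set" where
  "compatible_families D F i = {x \<in> (\<Pi>\<^sub>E d\<in>Obj D. carrier (Space (FObj F d) i)).
     \<forall>d\<in>Obj D. \<forall>d'\<in>Obj D. \<forall>f\<in>Arr D d d'. FArr F d d' f i (x d) = x d'}"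

text \<open>
  The limit cones that are computed separately at each vertex, where the limit of a diagram of
  modules consists of the compatible families.  These turn out to be all limit cones over small
  diagrams.
\<close>

definition vertexwise_limit ::
  "('k, 'x) ring_scheme \<Rightarrow> ('v, 'a) pre_digraph \<Rightarrow> ('d, 'e) cat
    \<Rightarrow> ('d, 'e, ('v, 'a, 'k, 'u) rep, 'v \<Rightarrow> 'u \<Rightarrow> 'u) fctr
    \<Rightarrow> ('v, 'a, 'k, 'u) rep \<Rightarrow> ('d \<Rightarrow> 'v \<Rightarrow> 'u \<Rightarrow> 'u) \<Rightarrow> bool" where
  "vertexwise_limit k Q D F L \<eta> \<longleftrightarrow> is_cone D (rep_cat k Q) F L \<eta> \<and>
     (\<forall>i\<in>verts Q. bij_betw (tuple (Obj D) (\<lambda>d. \<eta> d i)) (carrier (Space L i))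
                           (compatible_families D F i))"

lemma rep_coneD:
  assumes "is_cone D (rep_cat k Q) F M \<mu>"
  shows "M \<in> reps k Q"
    and "d \<in> Obj D \<Longrightarrow> \<mu> d \<in> rep_homs k Q M (FObj F d)"
    and "\<lbrakk>d \<in> Obj D; d' \<in> Obj D; f \<in> Arr D d d'; i \<in> verts Q; x \<in> carrier (Space M i)\<rbrakk>
      \<Longrightarrow> FArr F d d' f i (\<mu> d i x) = \<mu> d' i x"
proof -
  show "M \<in> reps k Q" "d \<in> Obj D \<Longrightarrow> \<mu> d \<in> rep_homs k Q M (FObj F d)"
    using assms by (auto simp: is_cone_def rep_cat_simps)
  assume d: "d \<in> Obj D" "d' \<in> Obj D" "f \<in> Arr D d d'" and i: "i \<in> verts Q" "x \<in> carrier (Space M i)"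
  have "Comp (rep_cat k Q) M (FObj F d) (FObj F d') (FArr F d d' f) (\<mu> d) = \<mu> d'"
    using assms d by (simp add: is_cone_def)
  then show "FArr F d d' f i (\<mu> d i x) = \<mu> d' i x"
    using rep_comp_apply[OF i] by metis
qed

lemma rep_coneI:
  assumes Q: "wf_digraph Q" and F: "is_functor D (rep_cat k Q) F"
    and M: "M \<in> reps k Q" and \<mu>: "\<And>d. d \<in> Obj D \<Longrightarrow> \<mu> d \<in> rep_homs k Q M (FObj F d)"
    and nat: "\<And>d d' f i x. \<lbrakk>d \<in> Obj D; d' \<in> Obj D; f \<in> Arr D d d'; i \<in> verts Q;
        x \<in> carrier (Space M i)\<rbrakk> \<Longrightarrow> FArr F d d' f i (\<mu> d i x) = \<mu> d' i x"
  shows "is_cone D (rep_cat k Q) F M \<mu>"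
proof -
  interpret F: is_functor D "rep_cat k Q" F by fact
  have "Comp (rep_cat k Q) M (FObj F d) (FObj F d') (FArr F d d' f) (\<mu> d) = \<mu> d'"
    if d: "d \<in> Obj D" "d' \<in> Obj D" "f \<in> Arr D d d'" for d d' f
  proof (rule rep_homs_eqI[OF rep_homs_comp_closed[OF Q M \<mu>] \<mu>])
    show "FArr F d d' f \<in> rep_homs k Q (FObj F d) (FObj F d')"
      using F.arr_closed d by (simp add: rep_cat_simps)
  qed (simp_all add: d rep_comp_apply nat)
  then show ?thesis
    using M \<mu> by (simp add: is_cone_def rep_cat_simps(1,2))
qed

lemma cone_tuple_compatible:
  assumes M: "is_cone D (rep_cat k Q) F M \<mu>" and i: "i \<in> verts Q" "x \<in> carrier (Space M i)"
  shows "tuple (Obj D) (\<lambda>d. \<mu> d i) x \<in> compatible_families D F i"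
  using rep_homs_apply_closed[OF rep_coneD(2)[OF M] i] rep_coneD(3)[OF M _ _ _ i]
  by (auto simp: compatible_families_def tuple_def)

lemma vertexwise_limitD:
  assumes "vertexwise_limit k Q D F L \<eta>"
  shows "is_cone D (rep_cat k Q) F L \<eta>"
    and "i \<in> verts Q \<Longrightarrow> bij_betw (tuple (Obj D) (\<lambda>d. \<eta> d i)) (carrier (Space L i))
      (compatible_families D F i)"
    and "\<lbrakk>i \<in> verts Q; x \<in> carrier (Space L i); y \<in> carrier (Space L i);
      \<And>d. d \<in> Obj D \<Longrightarrow> \<eta> d i x = \<eta> d i y\<rbrakk> \<Longrightarrow> x = y"
proof -
  show "is_cone D (rep_cat k Q) F L \<eta>"
    and bij: "i \<in> verts Q \<Longrightarrow> bij_betw (tuple (Obj D) (\<lambda>d. \<eta> d i)) (carrier (Space L i))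
      (compatible_families D F i)"
    using assms by (auto simp: vertexwise_limit_def)
  assume i: "i \<in> verts Q" and xy: "x \<in> carrier (Space L i)" "y \<in> carrier (Space L i)"
    and eq: "\<And>d. d \<in> Obj D \<Longrightarrow> \<eta> d i x = \<eta> d i y"
  have "tuple (Obj D) (\<lambda>d. \<eta> d i) x = tuple (Obj D) (\<lambda>d. \<eta> d i) y"
    using eq by (simp add: tuple_eq_iff)
  then show "x = y"
    using bij_betw_imp_inj_on[OF bij[OF i]] xy by (simp add: inj_on_eq_iff)
qed

text \<open>
  At each vertex the components of a cone form compatible families, which lift uniquely to
  \<open>L\<close>; the lifts commute with the structure maps because this can be tested after each \<open>\<eta> d\<close>.
\<close>

lemma is_limit_if_vertexwise:
  assumes Q: "wf_digraph Q" and F: "is_functor D (rep_cat k Q) F"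
    and L: "vertexwise_limit k Q D F L \<eta>"
  shows "is_limit D (rep_cat k Q) F L \<eta>"
proof -
  note cone = vertexwise_limitD(1)[OF L]
  have "\<exists>!h. h \<in> rep_homs k Q M L \<and>
      (\<forall>d\<in>Obj D. Comp (rep_cat k Q) M L (FObj F d) (\<eta> d) h = \<mu> d)"
    if M: "is_cone D (rep_cat k Q) F M \<mu>" for M \<mu>
  proof -
    have "\<exists>h\<in>linear_maps k (Space M i) (Space L i).
        \<forall>d\<in>Obj D. \<forall>x\<in>carrier (Space M i). \<eta> d i (h x) = \<mu> d i x" if i: "i \<in> verts Q" for i
      by (rule linear_lift[OF repsD(1)[OF rep_coneD(1)[OF cone] i]
            repsD(1)[OF rep_coneD(1)[OF M] i] rep_homsD(1)[OF rep_coneD(2)[OF cone] i]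
            vertexwise_limitD(2)[OF L i] rep_homsD(1)[OF rep_coneD(2)[OF M] i]
            cone_tuple_compatible[OF M i]])
    then obtain h where h: "\<And>i. i \<in> verts Q \<Longrightarrow> h i \<in> linear_maps k (Space M i) (Space L i)"
      "\<And>i d x. \<lbrakk>i \<in> verts Q; d \<in> Obj D; x \<in> carrier (Space M i)\<rbrakk> \<Longrightarrow> \<eta> d i (h i x) = \<mu> d i x"
      by metis
    let ?h = "restrict h (verts Q)"
    have h_hom: "?h \<in> rep_homs k Q M L"
    proof (rule rep_homsI)
      fix \<alpha> x assume \<alpha>: "\<alpha> \<in> arcs Q" and x: "x \<in> carrier (Space M (tail Q \<alpha>))"
      have v: "tail Q \<alpha> \<in> verts Q" "head Q \<alpha> \<in> verts Q"
        using Q \<alpha> by (simp_all add: wf_digraph_def)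
      note Mx = linear_mapsD(1)[OF repsD(2)[OF rep_coneD(1)[OF M] \<alpha>] x]
      note hx = linear_mapsD(1)[OF h(1)[OF v(1)] x]
      have "h (head Q \<alpha>) (Map M \<alpha> x) = Map L \<alpha> (h (tail Q \<alpha>) x)"
      proof (rule vertexwise_limitD(3)[OF L v(2)])
        show "h (head Q \<alpha>) (Map M \<alpha> x) \<in> carrier (Space L (head Q \<alpha>))"
          by (rule linear_mapsD(1)[OF h(1)[OF v(2)] Mx])
        show "Map L \<alpha> (h (tail Q \<alpha>) x) \<in> carrier (Space L (head Q \<alpha>))"
          by (rule linear_mapsD(1)[OF repsD(2)[OF rep_coneD(1)[OF cone] \<alpha>] hx])
        fix d assume d: "d \<in> Obj D"
        show "\<eta> d (head Q \<alpha>) (h (head Q \<alpha>) (Map M \<alpha> x))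
            = \<eta> d (head Q \<alpha>) (Map L \<alpha> (h (tail Q \<alpha>) x))"
          by (simp add: h(2) v d x Mx rep_homsD(2)[OF rep_coneD(2)[OF M d] \<alpha> x]
              rep_homsD(2)[OF rep_coneD(2)[OF cone d] \<alpha> hx])
      qed
      then show "?h (head Q \<alpha>) (Map M \<alpha> x) = Map L \<alpha> (?h (tail Q \<alpha>) x)"
        by (simp add: v)
    qed (simp_all add: h(1))
    note comp = rep_homs_comp_closed[OF Q rep_coneD(1)[OF M]]
    show ?thesis
    proof (rule ex1I[of _ ?h], intro conjI ballI h_hom)
      fix d assume d: "d \<in> Obj D"
      show "Comp (rep_cat k Q) M L (FObj F d) (\<eta> d) ?h = \<mu> d"
        by (rule rep_homs_eqI[OF comp[OF h_hom rep_coneD(2)[OF cone d]] rep_coneD(2)[OF M d]])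
          (simp add: rep_comp_apply h(2) d)
    next
      fix g assume g: "g \<in> rep_homs k Q M L \<and>
        (\<forall>d\<in>Obj D. Comp (rep_cat k Q) M L (FObj F d) (\<eta> d) g = \<mu> d)"
      show "g = ?h"
      proof (rule rep_homs_eqI[of _ k Q M L, OF _ h_hom])
        fix i x assume i: "i \<in> verts Q" and x: "x \<in> carrier (Space M i)"
        have "\<eta> d i (g i x) = \<mu> d i x" if "d \<in> Obj D" for d
          using g that rep_comp_apply[OF i x] by metis
        then have "g i x = h i x"
          using rep_homs_apply_closed[of g k Q M L, OF _ i x] g linear_mapsD(1)[OF h(1)[OF i] x]
          by - (rule vertexwise_limitD(3)[OF L i], simp_all add: h(2) i x)
        then show "g i x = ?h i x"
          by (simp add: i)
      qed (use g in blast)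
    qed
  qed
  then show ?thesis
    using cone by (simp add: is_limit_def rep_cat_simps(2))
qed

text \<open>
  Compatible families at a vertex form a submodule of the product over the small set of objects of
  \<open>D\<close>; the structure map of the limit along an arrow is induced by those of the \<open>FObj F d\<close>, which
  preserve compatibility because the transition maps are morphisms of representations.
\<close>

lemma ex_vertexwise_limit:
  fixes F :: "('d, 'e, ('v, 'a, 'k, 'u) rep, 'v \<Rightarrow> 'u \<Rightarrow> 'u) fctr"
  assumes k: "cring k" and Q: "wf_digraph Q" and small: "small TYPE('u) (Obj D)"
    and F: "is_functor D (rep_cat k Q) F"
  shows "\<exists>L \<eta>. vertexwise_limit k Q D F L \<eta>"
proof -
  interpret F: is_functor D "rep_cat k Q" F by fact
  have FO: "FObj F d \<in> reps k Q" if "d \<in> Obj D" for d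
    using F.obj_closed[OF that] by (simp add: rep_cat_simps)
  have FA: "FArr F d d' f \<in> rep_homs k Q (FObj F d) (FObj F d')"
    if "d \<in> Obj D" "d' \<in> Obj D" "f \<in> Arr D d d'" for d d' f
    using F.arr_closed[OF that] by (simp add: rep_cat_simps)
  have cf: "x d \<in> carrier (Space (FObj F d) i)"
    if "x \<in> compatible_families D F i" "d \<in> Obj D" for x d i
    using that by (auto simp: compatible_families_def PiE_iff)
  have cf_nat: "FArr F d d' f i (x d) = x d'"
    if "x \<in> compatible_families D F i" "d \<in> Obj D" "d' \<in> Obj D" "f \<in> Arr D d d'" for x d d' f i
    using that by (auto simp: compatible_families_def)
  have "\<exists>(L :: ('k, 'u) module) pr. module k L \<and>
      (\<forall>d\<in>Obj D. pr d \<in> linear_maps k L (Space (FObj F d) i)) \<and>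
      bij_betw (tuple (Obj D) pr) (carrier L) (compatible_families D F i)"
    if i: "i \<in> verts Q" for i
  proof (rule small_submodule_of_product[OF k small])
    show N: "module k (Space (FObj F d) i)" if "d \<in> Obj D" for d
      using repsD(1)[OF FO i] that by blast
    note lin = rep_homsD(1)[OF FA i]
    have ag: "abelian_group (Space (FObj F d) i)" if "d \<in> Obj D" for d
      using N[OF that] by (simp add: module_def)
    show "compatible_families D F i \<subseteq> (\<Pi>\<^sub>E d\<in>Obj D. carrier (Space (FObj F d) i))"
      by (auto simp: compatible_families_def)
    show "(\<lambda>d\<in>Obj D. \<zero>\<^bsub>Space (FObj F d) i\<^esub>) \<in> compatible_families D F i"
      by (auto simp: compatible_families_def linear_maps_zero[OF N N lin] abelian_groupE(2)[OF ag])
    show "(\<lambda>d\<in>Obj D. x d \<oplus>\<^bsub>Space (FObj F d) i\<^esub> y d) \<in> compatible_families D F i"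
      if "x \<in> compatible_families D F i" "y \<in> compatible_families D F i" for x y
      using that unfolding compatible_families_def[of D F i]
      by (auto simp: PiE_iff linear_mapsD(2)[OF lin] abelian_groupE(1)[OF ag])
    show "(\<lambda>d\<in>Obj D. c \<odot>\<^bsub>Space (FObj F d) i\<^esub> x d) \<in> compatible_families D F i"
      if "c \<in> carrier k" "x \<in> compatible_families D F i" for c x
      using that unfolding compatible_families_def[of D F i]
      by (auto simp: PiE_iff linear_mapsD(3)[OF lin] module.smult_closed[OF N])
  qed
  then obtain S :: "'v \<Rightarrow> ('k, 'u) module" and pr where
    S: "\<And>i. i \<in> verts Q \<Longrightarrow> module k (S i)"
    and pr: "\<And>i d. \<lbrakk>i \<in> verts Q; d \<in> Obj D\<rbrakk>
      \<Longrightarrow> pr i d \<in> linear_maps k (S i) (Space (FObj F d) i)"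
    and bij: "\<And>i. i \<in> verts Q \<Longrightarrow>
      bij_betw (tuple (Obj D) (pr i)) (carrier (S i)) (compatible_families D F i)"
    by metis
  have pr_cf: "tuple (Obj D) (pr i) x \<in> compatible_families D F i"
    if "i \<in> verts Q" "x \<in> carrier (S i)" for i x
    using bij[OF that(1)] that(2) by (auto simp: bij_betw_def)
  have "\<exists>h\<in>linear_maps k (S (tail Q \<alpha>)) (S (head Q \<alpha>)). \<forall>d\<in>Obj D. \<forall>x\<in>carrier (S (tail Q \<alpha>)).
      pr (head Q \<alpha>) d (h x) = Map (FObj F d) \<alpha> (pr (tail Q \<alpha>) d x)" if \<alpha>: "\<alpha> \<in> arcs Q" for \<alpha>
  proof -
    have v: "tail Q \<alpha> \<in> verts Q" "head Q \<alpha> \<in> verts Q"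
      using Q \<alpha> by (simp_all add: wf_digraph_def)
    define g where
      "g d = compose (carrier (S (tail Q \<alpha>))) (Map (FObj F d) \<alpha>) (pr (tail Q \<alpha>) d)" for d
    have "\<exists>h\<in>linear_maps k (S (tail Q \<alpha>)) (S (head Q \<alpha>)). \<forall>d\<in>Obj D. \<forall>x\<in>carrier (S (tail Q \<alpha>)).
        pr (head Q \<alpha>) d (h x) = g d x"
    proof (rule linear_lift[OF S[OF v(2)] S[OF v(1)] pr[OF v(2)] bij[OF v(2)]])
      show "g d \<in> linear_maps k (S (tail Q \<alpha>)) (Space (FObj F d) (head Q \<alpha>))" if "d \<in> Obj D" for d
        unfolding g_def
        by (rule linear_maps_compose[OF S[OF v(1)] pr[OF v(1) that] repsD(2)[OF FO[OF that] \<alpha>]])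
      fix x assume x: "x \<in> carrier (S (tail Q \<alpha>))"
      let ?y = "tuple (Obj D) (pr (tail Q \<alpha>)) x"
      have g: "g d x = Map (FObj F d) \<alpha> (?y d)" if "d \<in> Obj D" for d
        using x that by (simp add: g_def compose_def tuple_def)
      note y = pr_cf[OF v(1) x]
      have "FArr F d d' f (head Q \<alpha>) (g d x) = g d' x"
        if "d \<in> Obj D" "d' \<in> Obj D" "f \<in> Arr D d d'" for d d' f
        using rep_homsD(2)[OF FA[OF that] \<alpha> cf[OF y]] cf_nat[OF y that] that by (simp add: g)
      moreover have "g d x \<in> carrier (Space (FObj F d) (head Q \<alpha>))" if "d \<in> Obj D" for d
        using linear_mapsD(1)[OF repsD(2)[OF FO[OF that] \<alpha>] cf[OF y that]] that by (simp add: g)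
      ultimately show "tuple (Obj D) g x \<in> compatible_families D F (head Q \<alpha>)"
        by (auto simp: compatible_families_def tuple_def)
    qed
    then show ?thesis
      by (simp add: g_def compose_def)
  qed
  then obtain m where
    m: "\<And>\<alpha>. \<alpha> \<in> arcs Q \<Longrightarrow> m \<alpha> \<in> linear_maps k (S (tail Q \<alpha>)) (S (head Q \<alpha>))"
    and pr_m: "\<And>\<alpha> d x. \<lbrakk>\<alpha> \<in> arcs Q; d \<in> Obj D; x \<in> carrier (S (tail Q \<alpha>))\<rbrakk>
      \<Longrightarrow> pr (head Q \<alpha>) d (m \<alpha> x) = Map (FObj F d) \<alpha> (pr (tail Q \<alpha>) d x)"
    by metis
  define L where "L = \<lparr>Space = restrict S (verts Q), Map = restrict m (arcs Q)\<rparr>"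
  define \<eta> where "\<eta> d = (\<lambda>i\<in>verts Q. pr i d)" for d
  have v: "tail Q \<alpha> \<in> verts Q" "head Q \<alpha> \<in> verts Q" if "\<alpha> \<in> arcs Q" for \<alpha>
    using Q that by (simp_all add: wf_digraph_def)
  have "is_cone D (rep_cat k Q) F L \<eta>"
  proof (rule rep_coneI[OF Q F])
    show "L \<in> reps k Q"
      by (auto simp: L_def reps_def S m v)
    show "\<eta> d \<in> rep_homs k Q L (FObj F d)" if "d \<in> Obj D" for d
      using that by (intro rep_homsI) (auto simp: L_def \<eta>_def pr pr_m v)
    show "FArr F d d' f i (\<eta> d i x) = \<eta> d' i x" if d: "d \<in> Obj D" "d' \<in> Obj D" "f \<in> Arr D d d'"
      and i: "i \<in> verts Q" "x \<in> carrier (Space L i)" for d d' f i x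
      using cf_nat[OF pr_cf d, of i x] i d by (simp add: \<eta>_def L_def tuple_def)
  qed
  moreover have "bij_betw (tuple (Obj D) (\<lambda>d. \<eta> d i)) (carrier (Space L i))
      (compatible_families D F i)" if "i \<in> verts Q" for i
    using bij[OF that] that by (simp add: \<eta>_def L_def)
  ultimately show ?thesis
    unfolding vertexwise_limit_def by blast
qed

text \<open>
  A limit is isomorphic to the vertexwise limit constructed above, and the property of being
  vertexwise is invariant under isomorphism of cones.
\<close>

lemma vertexwise_if_is_limit:
  fixes F :: "('d, 'e, ('v, 'a, 'k, 'u) rep, 'v \<Rightarrow> 'u \<Rightarrow> 'u) fctr"
  assumes k: "cring k" and Q: "wf_digraph Q" and small: "small TYPE('u) (Obj D)"
    and F: "is_functor D (rep_cat k Q) F" and M: "is_limit D (rep_cat k Q) F M \<mu>"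
  shows "vertexwise_limit k Q D F M \<mu>"
proof -
  obtain L \<eta> where L: "vertexwise_limit k Q D F L \<eta>"
    using ex_vertexwise_limit[OF k Q small F] by blast
  obtain g h where "g \<in> rep_homs k Q M L" "h \<in> rep_homs k Q L M"
    "Comp (rep_cat k Q) M L M h g = Ident (rep_cat k Q) M"
    "\<And>d. d \<in> Obj D \<Longrightarrow> Comp (rep_cat k Q) M L (FObj F d) (\<eta> d) g = \<mu> d"
    "\<And>d. d \<in> Obj D \<Longrightarrow> Comp (rep_cat k Q) L M (FObj F d) (\<mu> d) h = \<eta> d"
    using is_limit_iso[OF category_rep_cat[OF Q] F is_limit_if_vertexwise[OF Q F L] M]
    unfolding rep_cat_simps(2) by metis
  note gh = this
  have cone: "is_cone D (rep_cat k Q) F M \<mu>"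
    using M by (simp add: is_limit_def)
  have "bij_betw (tuple (Obj D) (\<lambda>d. \<mu> d i)) (carrier (Space M i)) (compatible_families D F i)"
    if i: "i \<in> verts Q" for i
  proof -
    have hg: "h i (g i x) = x" if "x \<in> carrier (Space M i)" for x
      using rep_comp_apply[OF i that, of k L M h g] gh(3) i that by (simp add: rep_cat_simps(4))
    have \<eta>g: "\<eta> d i (g i x) = \<mu> d i x" if "x \<in> carrier (Space M i)" "d \<in> Obj D" for x d
      using rep_comp_apply[OF i that(1)] gh(4)[OF that(2)] by metis
    have \<mu>h: "\<mu> d i (h i x) = \<eta> d i x" if "x \<in> carrier (Space L i)" "d \<in> Obj D" for x d
      using rep_comp_apply[OF i that(1)] gh(5)[OF that(2)] by metis
    note closed = rep_homs_apply_closed[OF gh(1) i] rep_homs_apply_closed[OF gh(2) i]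
    show ?thesis
    proof (rule bij_betw_imageI)
      show "inj_on (tuple (Obj D) (\<lambda>d. \<mu> d i)) (carrier (Space M i))"
      proof (rule inj_onI)
        fix x y assume xy: "x \<in> carrier (Space M i)" "y \<in> carrier (Space M i)"
          "tuple (Obj D) (\<lambda>d. \<mu> d i) x = tuple (Obj D) (\<lambda>d. \<mu> d i) y"
        have "g i x = g i y"
          using xy by - (rule vertexwise_limitD(3)[OF L i], simp_all add: closed \<eta>g tuple_eq_iff)
        then show "x = y"
          using hg xy by metis
      qed
      have "z \<in> tuple (Obj D) (\<lambda>d. \<mu> d i) ` carrier (Space M i)"
        if "z \<in> compatible_families D F i" for z
      proof -
        have "z \<in> tuple (Obj D) (\<lambda>d. \<eta> d i) ` carrier (Space L i)"
          using that by (simp add: bij_betw_imp_surj_on[OF vertexwise_limitD(2)[OF L i]])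
        then obtain x where x: "x \<in> carrier (Space L i)" "z = tuple (Obj D) (\<lambda>d. \<eta> d i) x"
          by (elim imageE)
        then have "z = tuple (Obj D) (\<lambda>d. \<mu> d i) (h i x)"
          by (simp add: tuple_eq_iff \<mu>h)
        then show ?thesis
          using closed(2)[OF x(1)] by (rule image_eqI)
      qed
      then show "tuple (Obj D) (\<lambda>d. \<mu> d i) ` carrier (Space M i) = compatible_families D F i"
        using cone_tuple_compatible[OF cone i] by (intro equalityI subsetI) (elim imageE, simp)
    qed
  qed
  then show ?thesis
    using cone by (simp add: vertexwise_limit_def)
qed

section \<open>Limits of birepresentations\<close>

lemma birep_cat_simps:
  "Obj (birep_cat k Q Q') = bireps k Q Q'"
  "Arr (birep_cat k Q Q') = birep_homs k Q Q'"
  "Comp (birep_cat k Q Q') x y z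
    = Comp (prod_cat (rep_cat k Q) (rep_cat k Q')) (forget_obj x) (forget_obj y) (forget_obj z)"
  "Ident (birep_cat k Q Q') x = Ident (prod_cat (rep_cat k Q) (rep_cat k Q')) (forget_obj x)"
  by (simp_all add: birep_cat_def)

lemma birep_comp_eq:
  "Comp (birep_cat k Q Q') (U, U', \<chi>) (V, V', \<psi>) (W, W', \<theta>) (g, g') (f, f')
    = (Comp (rep_cat k Q) U V W g f, Comp (rep_cat k Q') U' V' W' g' f')"
  by (simp add: birep_cat_simps forget_obj_def prod_cat_def)

lemma birep_homs_iff:
  "(f, f') \<in> birep_homs k Q Q' (V, V', \<psi>) (W, W', \<theta>) \<longleftrightarrow>
     f \<in> rep_homs k Q V W \<and> f' \<in> rep_homs k Q' V' W' \<and>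
     (\<forall>\<alpha>\<in>arcs Q. \<forall>\<beta>\<in>arcs Q'. \<forall>x\<in>carrier (Space V (head Q \<alpha>)).
        f' (tail Q' \<beta>) (\<psi> (\<alpha>, \<beta>) x) = \<theta> (\<alpha>, \<beta>) (f (head Q \<alpha>) x))"
  by (simp add: birep_homs_def)

lemma birepsD:
  assumes "(V, V', \<psi>) \<in> bireps k Q Q'"
  shows "V \<in> reps k Q" "V' \<in> reps k Q'"
    "\<lbrakk>\<alpha> \<in> arcs Q; \<beta> \<in> arcs Q'\<rbrakk>
      \<Longrightarrow> \<psi> (\<alpha>, \<beta>) \<in> linear_maps k (Space V (head Q \<alpha>)) (Space V' (tail Q' \<beta>))"
  using assms by (auto simp: bireps_def PiE_iff)

lemma forget_bireps:
  assumes "x \<in> bireps k Q Q'"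
  shows "forget_obj x \<in> Obj (prod_cat (rep_cat k Q) (rep_cat k Q'))"
  using assms by (auto simp: bireps_def forget_obj_def prod_cat_def rep_cat_simps)

lemma forget_birep_homs:
  assumes "f \<in> birep_homs k Q Q' x y"
  shows "f \<in> Arr (prod_cat (rep_cat k Q) (rep_cat k Q')) (forget_obj x) (forget_obj y)"
  using assms
  by (auto simp: birep_homs_def forget_obj_def prod_cat_def rep_cat_simps split: prod.splits)

lemma birep_homs_comp_closed:
  assumes Q: "wf_digraph Q" and Q': "wf_digraph Q'" and U: "(U, U', \<chi>) \<in> bireps k Q Q'"
    and f: "(f, f') \<in> birep_homs k Q Q' (U, U', \<chi>) (V, V', \<psi>)"
    and g: "(g, g') \<in> birep_homs k Q Q' (V, V', \<psi>) (W, W', \<theta>)"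
  shows "(Comp (rep_cat k Q) U V W g f, Comp (rep_cat k Q') U' V' W' g' f')
    \<in> birep_homs k Q Q' (U, U', \<chi>) (W, W', \<theta>)"
  unfolding birep_homs_iff
proof (intro conjI ballI)
  have f1: "f \<in> rep_homs k Q U V" "f' \<in> rep_homs k Q' U' V'"
    and g1: "g \<in> rep_homs k Q V W" "g' \<in> rep_homs k Q' V' W'"
    using f g by (simp_all add: birep_homs_iff)
  show "Comp (rep_cat k Q) U V W g f \<in> rep_homs k Q U W"
    by (rule rep_homs_comp_closed[OF Q birepsD(1)[OF U] f1(1) g1(1)])
  show "Comp (rep_cat k Q') U' V' W' g' f' \<in> rep_homs k Q' U' W'"
    by (rule rep_homs_comp_closed[OF Q' birepsD(2)[OF U] f1(2) g1(2)])
  fix \<alpha> \<beta> x assume \<alpha>: "\<alpha> \<in> arcs Q" and \<beta>: "\<beta> \<in> arcs Q'"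
    and x: "x \<in> carrier (Space U (head Q \<alpha>))"
  have v: "head Q \<alpha> \<in> verts Q" "tail Q' \<beta> \<in> verts Q'"
    using Q Q' \<alpha> \<beta> by (simp_all add: wf_digraph_def)
  show "Comp (rep_cat k Q') U' V' W' g' f' (tail Q' \<beta>) (\<chi> (\<alpha>, \<beta>) x)
      = \<theta> (\<alpha>, \<beta>) (Comp (rep_cat k Q) U V W g f (head Q \<alpha>) x)"
    using f g \<alpha> \<beta> x rep_homs_apply_closed[OF f1(1) v(1) x]
    by (simp add: birep_homs_iff rep_comp_apply v linear_mapsD(1)[OF birepsD(3)[OF U \<alpha> \<beta>] x])
qed

lemma birep_homs_ident:
  assumes Q: "wf_digraph Q" and Q': "wf_digraph Q'" and V: "(V, V', \<psi>) \<in> bireps k Q Q'"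
  shows "(Ident (rep_cat k Q) V, Ident (rep_cat k Q') V')
    \<in> birep_homs k Q Q' (V, V', \<psi>) (V, V', \<psi>)"
  unfolding birep_homs_iff
proof (intro conjI ballI)
  fix \<alpha> \<beta> x assume \<alpha>: "\<alpha> \<in> arcs Q" and \<beta>: "\<beta> \<in> arcs Q'"
    and x: "x \<in> carrier (Space V (head Q \<alpha>))"
  then show "Ident (rep_cat k Q') V' (tail Q' \<beta>) (\<psi> (\<alpha>, \<beta>) x)
      = \<psi> (\<alpha>, \<beta>) (Ident (rep_cat k Q) V (head Q \<alpha>) x)"
    using Q Q' linear_mapsD(1)[OF birepsD(3)[OF V \<alpha> \<beta>] x]
    by (simp add: rep_cat_simps wf_digraph_def)
qed (simp_all add: rep_homs_ident[OF Q birepsD(1)[OF V]] rep_homs_ident[OF Q' birepsD(2)[OF V]])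

text \<open>
  Since composition and identities are those of the product category, so are the laws.
\<close>

lemma category_birep_cat:
  assumes Q: "wf_digraph Q" and Q': "wf_digraph Q'"
  shows "category (birep_cat k Q Q')"
proof -
  interpret P: category "prod_cat (rep_cat k Q) (rep_cat k Q')"
    by (rule category_prod_cat[OF category_rep_cat[OF Q] category_rep_cat[OF Q']])
  show ?thesis
  proof
    fix x y z f g
    assume xyz: "x \<in> Obj (birep_cat k Q Q')" "f \<in> Arr (birep_cat k Q Q') x y"
      "g \<in> Arr (birep_cat k Q Q') y z"
    obtain U U' \<chi> V V' \<psi> W W' \<theta> f1 f2 g1 g2 where
      "x = (U, U', \<chi>)" "y = (V, V', \<psi>)" "z = (W, W', \<theta>)" "f = (f1, f2)" "g = (g1, g2)"
      by (metis surj_pair)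
    then show "Comp (birep_cat k Q Q') x y z g f \<in> Arr (birep_cat k Q Q') x z"
      using xyz birep_homs_comp_closed[OF Q Q'] by (simp add: birep_comp_eq birep_cat_simps(1,2))
  next
    fix x assume x: "x \<in> Obj (birep_cat k Q Q')"
    obtain V V' \<psi> where "x = (V, V', \<psi>)"
      by (cases x)
    then show "Ident (birep_cat k Q Q') x \<in> Arr (birep_cat k Q Q') x x"
      using x birep_homs_ident[OF Q Q'] by (simp add: birep_cat_simps forget_obj_def prod_cat_def)
  next
    fix x y f
    assume "x \<in> Obj (birep_cat k Q Q')" "y \<in> Obj (birep_cat k Q Q')"
      "f \<in> Arr (birep_cat k Q Q') x y"
    then have P: "forget_obj x \<in> Obj (prod_cat (rep_cat k Q) (rep_cat k Q'))"
      "forget_obj y \<in> Obj (prod_cat (rep_cat k Q) (rep_cat k Q'))"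
      "f \<in> Arr (prod_cat (rep_cat k Q) (rep_cat k Q')) (forget_obj x) (forget_obj y)"
      by (simp_all add: birep_cat_simps forget_bireps forget_birep_homs)
    show "Comp (birep_cat k Q Q') x x y f (Ident (birep_cat k Q Q') x) = f"
      unfolding birep_cat_simps by (rule P.comp_ident_right[OF P])
    show "Comp (birep_cat k Q Q') x y y (Ident (birep_cat k Q Q') y) f = f"
      unfolding birep_cat_simps by (rule P.comp_ident_left[OF P])
  next
    fix w x y z f g h
    assume "w \<in> Obj (birep_cat k Q Q')" "x \<in> Obj (birep_cat k Q Q')"
      "y \<in> Obj (birep_cat k Q Q')" "z \<in> Obj (birep_cat k Q Q')"
      "f \<in> Arr (birep_cat k Q Q') w x" "g \<in> Arr (birep_cat k Q Q') x y"
      "h \<in> Arr (birep_cat k Q Q') y z"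
    then show "Comp (birep_cat k Q Q') w y z h (Comp (birep_cat k Q Q') w x y g f)
        = Comp (birep_cat k Q Q') w x z (Comp (birep_cat k Q Q') x y z h g) f"
      unfolding birep_cat_simps
      by (intro P.comp_assoc forget_bireps forget_birep_homs)
  qed
qed

lemma is_functor_forgetful:
  assumes Q: "wf_digraph Q" and Q': "wf_digraph Q'"
  shows "is_functor (birep_cat k Q Q') (prod_cat (rep_cat k Q) (rep_cat k Q')) forgetful"
  by (rule is_functorI[OF category_birep_cat[OF Q Q']
        category_prod_cat[OF category_rep_cat[OF Q] category_rep_cat[OF Q']]])
    (auto simp: forgetful_def birep_cat_simps forget_bireps forget_birep_homs)

lemma birep_coneD:
  assumes "is_cone D (birep_cat k Q Q') F (M, M', \<chi>) \<mu>"
  shows "is_cone D (rep_cat k Q) (fst_fctr \<circ>\<^sub>F forgetful \<circ>\<^sub>F F) M (\<lambda>d. fst (\<mu> d))"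
    and "is_cone D (rep_cat k Q') (snd_fctr \<circ>\<^sub>F forgetful \<circ>\<^sub>F F) M' (\<lambda>d. snd (\<mu> d))"
proof -
  have "is_cone D (prod_cat (rep_cat k Q) (rep_cat k Q')) (forgetful \<circ>\<^sub>F F) (M, M') \<mu>"
    unfolding is_cone_def
  proof (intro conjI ballI)
    have M: "forget_obj (M, M', \<chi>) = (M, M')"
      by (simp add: forget_obj_def)
    note cone = assms[unfolded is_cone_def]
    show "(M, M') \<in> Obj (prod_cat (rep_cat k Q) (rep_cat k Q'))"
      using cone forget_bireps[where x = "(M, M', \<chi>)" and k = k and Q = Q and Q' = Q'] by (simp add: M birep_cat_simps(1))
    show "\<mu> d \<in> Arr (prod_cat (rep_cat k Q) (rep_cat k Q')) (M, M') (FObj (forgetful \<circ>\<^sub>F F) d)"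
      if "d \<in> Obj D" for d
      using cone that forget_birep_homs[where k = k and Q = Q and Q' = Q' and f = "\<mu> d" and x = "(M, M', \<chi>)" and y = "FObj F d"]
      by (simp add: M birep_cat_simps(2) comp_fctr_def forgetful_def)
    show "Comp (prod_cat (rep_cat k Q) (rep_cat k Q')) (M, M') (FObj (forgetful \<circ>\<^sub>F F) d)
        (FObj (forgetful \<circ>\<^sub>F F) d') (FArr (forgetful \<circ>\<^sub>F F) d d' f) (\<mu> d) = \<mu> d'"
      if "d \<in> Obj D" "d' \<in> Obj D" "f \<in> Arr D d d'" for d d' f
      using cone that by (simp add: M birep_cat_simps(3) comp_fctr_def forgetful_def)
  qed
  then show "is_cone D (rep_cat k Q) (fst_fctr \<circ>\<^sub>F forgetful \<circ>\<^sub>F F) M (\<lambda>d. fst (\<mu> d))"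
    "is_cone D (rep_cat k Q') (snd_fctr \<circ>\<^sub>F forgetful \<circ>\<^sub>F F) M' (\<lambda>d. snd (\<mu> d))"
    by (simp_all add: is_cone_prod_cat_iff)
qed

lemma birep_coneI:
  assumes F: "is_functor D (birep_cat k Q Q') F" and M: "(M, M', \<chi>) \<in> bireps k Q Q'"
    and \<mu>: "\<And>d. d \<in> Obj D \<Longrightarrow> (\<mu> d, \<mu>' d) \<in> birep_homs k Q Q' (M, M', \<chi>) (FObj F d)"
    and cone: "is_cone D (rep_cat k Q) (fst_fctr \<circ>\<^sub>F forgetful \<circ>\<^sub>F F) M \<mu>"
      "is_cone D (rep_cat k Q') (snd_fctr \<circ>\<^sub>F forgetful \<circ>\<^sub>F F) M' \<mu>'"
  shows "is_cone D (birep_cat k Q Q') F (M, M', \<chi>) (\<lambda>d. (\<mu> d, \<mu>' d))"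
proof -
  have "is_cone D (prod_cat (rep_cat k Q) (rep_cat k Q')) (forgetful \<circ>\<^sub>F F)
      (M, M') (\<lambda>d. (\<mu> d, \<mu>' d))"
    using cone by (simp add: is_cone_prod_cat_iff)
  moreover have "forget_obj (M, M', \<chi>) = (M, M')"
    by (simp add: forget_obj_def)
  ultimately show ?thesis
    using M \<mu> by (simp add: is_cone_def birep_cat_simps comp_fctr_def forgetful_def)
qed

text \<open>
  For \<open>x\<close> in \<open>L\<close> the vectors obtained by applying the maps of the \<open>FObj F d\<close> to the components of
  \<open>x\<close> form a compatible family at \<open>tail Q' \<beta>\<close>, because the transition maps are morphisms of
  birepresentations; as \<open>L'\<close> is computed vertexwise, the family determines a vector of \<open>L'\<close>.  This
  defines the unique \<open>\<psi>'\<close> for which all \<open>(\<eta> d, \<eta>' d)\<close> are morphisms.  The mediating pair of a cone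
  then commutes with \<open>\<psi>'\<close>, as can be tested after the jointly injective \<open>\<eta>' d\<close>.
\<close>

lemma ex_birep_limit:
  fixes F :: "('d, 'e, ('v, 'a, 'w, 'b, 'k, 'u) birep, _) fctr"
  assumes k: "cring k" and Q: "wf_digraph Q" and Q': "wf_digraph Q'"
    and small: "small TYPE('u) (Obj D)" and F: "is_functor D (birep_cat k Q Q') F"
    and L: "is_limit D (rep_cat k Q) (fst_fctr \<circ>\<^sub>F forgetful \<circ>\<^sub>F F) L \<eta>"
    and L': "is_limit D (rep_cat k Q') (snd_fctr \<circ>\<^sub>F forgetful \<circ>\<^sub>F F) L' \<eta>'"
  shows "\<exists>\<psi>'. (L, L', \<psi>') \<in> bireps k Q Q' \<and>
    is_limit D (birep_cat k Q Q') F (L, L', \<psi>') (\<lambda>d. (\<eta> d, \<eta>' d))"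
proof -
  interpret F: is_functor D "birep_cat k Q Q'" F by fact
  define F1 where "F1 = fst_fctr \<circ>\<^sub>F forgetful \<circ>\<^sub>F F"
  define F2 where "F2 = snd_fctr \<circ>\<^sub>F forgetful \<circ>\<^sub>F F"
  define \<psi> where "\<psi> d = snd (snd (FObj F d))" for d
  have F_obj: "FObj F d = (FObj F1 d, FObj F2 d, \<psi> d)" for d
    by (simp add: F1_def F2_def \<psi>_def comp_fctr_def fst_fctr_def snd_fctr_def forgetful_def
        forget_obj_def split: prod.split)
  have F_arr: "FArr F d d' f = (FArr F1 d d' f, FArr F2 d d' f)" for d d' f
    by (simp add: F1_def F2_def comp_fctr_def fst_fctr_def snd_fctr_def forgetful_def)
  have V: "(FObj F1 d, FObj F2 d, \<psi> d) \<in> bireps k Q Q'" if "d \<in> Obj D" for d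
    using F.obj_closed[OF that] by (simp add: birep_cat_simps F_obj)
  have A: "(FArr F1 d d' f, FArr F2 d d' f) \<in> birep_homs k Q Q'
      (FObj F1 d, FObj F2 d, \<psi> d) (FObj F1 d', FObj F2 d', \<psi> d')"
    if "d \<in> Obj D" "d' \<in> Obj D" "f \<in> Arr D d d'" for d d' f
    using F.arr_closed[OF that] by (simp add: birep_cat_simps F_obj F_arr)
  note functors = is_functor_comp[OF is_functor_comp[OF F is_functor_forgetful[OF Q Q']]]
  have "is_functor D (rep_cat k Q') F2"
    unfolding F2_def
    by (rule functors[OF is_functor_snd_fctr[OF category_rep_cat[OF Q] category_rep_cat[OF Q']]])
  then have vw: "vertexwise_limit k Q' D F2 L' \<eta>'"
    using vertexwise_if_is_limit[OF k Q' small] L' F2_def by blast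
  have cone: "is_cone D (rep_cat k Q) F1 L \<eta>" and cone': "is_cone D (rep_cat k Q') F2 L' \<eta>'"
    using L L' by (simp_all add: is_limit_def F1_def F2_def)
  have "\<exists>h\<in>linear_maps k (Space L (head Q \<alpha>)) (Space L' (tail Q' \<beta>)).
      \<forall>d\<in>Obj D. \<forall>x\<in>carrier (Space L (head Q \<alpha>)).
        \<eta>' d (tail Q' \<beta>) (h x) = \<psi> d (\<alpha>, \<beta>) (\<eta> d (head Q \<alpha>) x)"
    if \<alpha>: "\<alpha> \<in> arcs Q" and \<beta>: "\<beta> \<in> arcs Q'" for \<alpha> \<beta>
  proof -
    have v: "head Q \<alpha> \<in> verts Q" "tail Q' \<beta> \<in> verts Q'"
      using Q Q' \<alpha> \<beta> by (simp_all add: wf_digraph_def)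
    note LM = repsD(1)[OF rep_coneD(1)[OF cone] v(1)]
    note \<psi>_lin = birepsD(3)[OF V \<alpha> \<beta>]
    note \<eta>x = rep_homs_apply_closed[OF rep_coneD(2)[OF cone] v(1)]
    define g where "g d = compose (carrier (Space L (head Q \<alpha>))) (\<psi> d (\<alpha>, \<beta>)) (\<eta> d (head Q \<alpha>))"
      for d
    have g: "g d x = \<psi> d (\<alpha>, \<beta>) (\<eta> d (head Q \<alpha>) x)" if "x \<in> carrier (Space L (head Q \<alpha>))" for d x
      using that by (simp add: g_def compose_def)
    have "\<exists>h\<in>linear_maps k (Space L (head Q \<alpha>)) (Space L' (tail Q' \<beta>)).
        \<forall>d\<in>Obj D. \<forall>x\<in>carrier (Space L (head Q \<alpha>)). \<eta>' d (tail Q' \<beta>) (h x) = g d x"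
    proof (rule linear_lift[OF repsD(1)[OF rep_coneD(1)[OF cone'] v(2)] LM
          rep_homsD(1)[OF rep_coneD(2)[OF cone'] v(2)] vertexwise_limitD(2)[OF vw v(2)]])
      show "g d \<in> linear_maps k (Space L (head Q \<alpha>)) (Space (FObj F2 d) (tail Q' \<beta>))"
        if d: "d \<in> Obj D" for d
        unfolding g_def
        by (rule linear_maps_compose[OF LM rep_homsD(1)[OF rep_coneD(2)[OF cone d] v(1)] \<psi>_lin[OF d]])
      fix x assume x: "x \<in> carrier (Space L (head Q \<alpha>))"
      have "g d x \<in> carrier (Space (FObj F2 d) (tail Q' \<beta>))" if d: "d \<in> Obj D" for d
        unfolding g[OF x] by (rule linear_mapsD(1)[OF \<psi>_lin[OF d] \<eta>x[OF d x]])
      moreover have "FArr F2 d d' f (tail Q' \<beta>) (g d x) = g d' x"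
        if d: "d \<in> Obj D" "d' \<in> Obj D" "f \<in> Arr D d d'" for d d' f
        using A[OF d] \<alpha> \<beta> \<eta>x[OF d(1) x] rep_coneD(3)[OF cone d v(1) x]
        by (simp add: birep_homs_iff g[OF x])
      ultimately show "tuple (Obj D) g x \<in> compatible_families D F2 (tail Q' \<beta>)"
        by (auto simp: compatible_families_def tuple_def)
    qed
    then show ?thesis
      by (simp add: g)
  qed
  then obtain h where
    h: "\<And>\<alpha> \<beta>. \<lbrakk>\<alpha> \<in> arcs Q; \<beta> \<in> arcs Q'\<rbrakk>
      \<Longrightarrow> h \<alpha> \<beta> \<in> linear_maps k (Space L (head Q \<alpha>)) (Space L' (tail Q' \<beta>))"
    and \<eta>h: "\<And>\<alpha> \<beta> d x. \<lbrakk>\<alpha> \<in> arcs Q; \<beta> \<in> arcs Q'; d \<in> Obj D; x \<in> carrier (Space L (head Q \<alpha>))\<rbrakk>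
      \<Longrightarrow> \<eta>' d (tail Q' \<beta>) (h \<alpha> \<beta> x) = \<psi> d (\<alpha>, \<beta>) (\<eta> d (head Q \<alpha>) x)"
    by metis
  define \<psi>' where "\<psi>' = (\<lambda>(\<alpha>, \<beta>)\<in>arcs Q \<times> arcs Q'. h \<alpha> \<beta>)"
  have \<psi>': "\<psi>' (\<alpha>, \<beta>) = h \<alpha> \<beta>" if "\<alpha> \<in> arcs Q" "\<beta> \<in> arcs Q'" for \<alpha> \<beta>
    using that by (simp add: \<psi>'_def)
  have LL': "(L, L', \<psi>') \<in> bireps k Q Q'"
    using h rep_coneD(1)[OF cone] rep_coneD(1)[OF cone'] by (auto simp: bireps_def \<psi>'_def)
  have birep_cone: "is_cone D (birep_cat k Q Q') F (L, L', \<psi>') (\<lambda>d. (\<eta> d, \<eta>' d))"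
  proof (rule birep_coneI[OF F LL'])
    show "(\<eta> d, \<eta>' d) \<in> birep_homs k Q Q' (L, L', \<psi>') (FObj F d)" if d: "d \<in> Obj D" for d
      unfolding F_obj birep_homs_iff
      using rep_coneD(2)[OF cone d] rep_coneD(2)[OF cone' d] by (simp add: \<psi>' \<eta>h d)
  qed (use cone cone' in \<open>simp_all add: F1_def F2_def\<close>)
  have "\<exists>!u. u \<in> Arr (birep_cat k Q Q') N (L, L', \<psi>') \<and>
      (\<forall>d\<in>Obj D. Comp (birep_cat k Q Q') N (L, L', \<psi>') (FObj F d) (\<eta> d, \<eta>' d) u = \<mu> d)"
    if "is_cone D (birep_cat k Q Q') F N \<mu>" for N \<mu>
  proof -
    obtain M M' \<chi> where N: "N = (M, M', \<chi>)"
      by (cases N)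
    have bc: "is_cone D (birep_cat k Q Q') F (M, M', \<chi>) \<mu>"
      using that by (simp add: N)
    then have M: "(M, M', \<chi>) \<in> bireps k Q Q'"
      and \<mu>: "\<And>d. d \<in> Obj D \<Longrightarrow>
        (fst (\<mu> d), snd (\<mu> d)) \<in> birep_homs k Q Q' (M, M', \<chi>) (FObj F1 d, FObj F2 d, \<psi> d)"
      by (simp_all add: is_cone_def birep_cat_simps F_obj)
    note Mcone = birep_coneD[OF bc, folded F1_def F2_def]
    have ex1: "\<exists>!u. (fst u \<in> rep_homs k Q M L \<and>
          (\<forall>d\<in>Obj D. Comp (rep_cat k Q) M L (FObj F1 d) (\<eta> d) (fst u) = fst (\<mu> d))) \<and>
        (snd u \<in> rep_homs k Q' M' L' \<and>
          (\<forall>d\<in>Obj D. Comp (rep_cat k Q') M' L' (FObj F2 d) (\<eta>' d) (snd u) = snd (\<mu> d)))"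
      by (rule ex1_pair[OF
            is_limitD_ex1[OF L[folded F1_def] Mcone(1), unfolded rep_cat_simps(2)]
            is_limitD_ex1[OF L'[folded F2_def] Mcone(2), unfolded rep_cat_simps(2)]])
    have hom: "(g, g') \<in> birep_homs k Q Q' (M, M', \<chi>) (L, L', \<psi>')"
      if g: "g \<in> rep_homs k Q M L" "g' \<in> rep_homs k Q' M' L'"
        and comp: "\<forall>d\<in>Obj D. Comp (rep_cat k Q) M L (FObj F1 d) (\<eta> d) g = fst (\<mu> d)"
          "\<forall>d\<in>Obj D. Comp (rep_cat k Q') M' L' (FObj F2 d) (\<eta>' d) g' = snd (\<mu> d)"
      for g g'
      unfolding birep_homs_iff
    proof (intro conjI ballI g)
      fix \<alpha> \<beta> x assume \<alpha>: "\<alpha> \<in> arcs Q" and \<beta>: "\<beta> \<in> arcs Q'"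
        and x: "x \<in> carrier (Space M (head Q \<alpha>))"
      have v: "head Q \<alpha> \<in> verts Q" "tail Q' \<beta> \<in> verts Q'"
        using Q Q' \<alpha> \<beta> by (simp_all add: wf_digraph_def)
      note gx = rep_homs_apply_closed[OF g(1) v(1) x]
      note \<chi>x = linear_mapsD(1)[OF birepsD(3)[OF M \<alpha> \<beta>] x]
      have "g' (tail Q' \<beta>) (\<chi> (\<alpha>, \<beta>) x) = h \<alpha> \<beta> (g (head Q \<alpha>) x)"
      proof (rule vertexwise_limitD(3)[OF vw v(2) rep_homs_apply_closed[OF g(2) v(2) \<chi>x]
            linear_mapsD(1)[OF h[OF \<alpha> \<beta>] gx]])
        fix d assume d: "d \<in> Obj D"
        have "\<eta>' d (tail Q' \<beta>) (g' (tail Q' \<beta>) (\<chi> (\<alpha>, \<beta>) x)) = snd (\<mu> d) (tail Q' \<beta>) (\<chi> (\<alpha>, \<beta>) x)"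
          using rep_comp_apply[OF v(2) \<chi>x] bspec[OF comp(2) d] by metis
        also have "\<dots> = \<psi> d (\<alpha>, \<beta>) (fst (\<mu> d) (head Q \<alpha>) x)"
          using \<mu>[OF d] \<alpha> \<beta> x unfolding birep_homs_iff by blast
        also have "fst (\<mu> d) (head Q \<alpha>) x = \<eta> d (head Q \<alpha>) (g (head Q \<alpha>) x)"
          using rep_comp_apply[OF v(1) x] bspec[OF comp(1) d] by metis
        also have "\<psi> d (\<alpha>, \<beta>) \<dots> = \<eta>' d (tail Q' \<beta>) (h \<alpha> \<beta> (g (head Q \<alpha>) x))"
          by (rule \<eta>h[OF \<alpha> \<beta> d gx, symmetric])
        finally show "\<eta>' d (tail Q' \<beta>) (g' (tail Q' \<beta>) (\<chi> (\<alpha>, \<beta>) x))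
            = \<eta>' d (tail Q' \<beta>) (h \<alpha> \<beta> (g (head Q \<alpha>) x))" .
      qed
      then show "g' (tail Q' \<beta>) (\<chi> (\<alpha>, \<beta>) x) = \<psi>' (\<alpha>, \<beta>) (g (head Q \<alpha>) x)"
        by (simp add: \<psi>' \<alpha> \<beta>)
    qed
    have "(u \<in> Arr (birep_cat k Q Q') N (L, L', \<psi>') \<and>
        (\<forall>d\<in>Obj D. Comp (birep_cat k Q Q') N (L, L', \<psi>') (FObj F d) (\<eta> d, \<eta>' d) u = \<mu> d)) \<longleftrightarrow>
      (fst u \<in> rep_homs k Q M L \<and>
          (\<forall>d\<in>Obj D. Comp (rep_cat k Q) M L (FObj F1 d) (\<eta> d) (fst u) = fst (\<mu> d))) \<and>
        (snd u \<in> rep_homs k Q' M' L' \<and>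
          (\<forall>d\<in>Obj D. Comp (rep_cat k Q') M' L' (FObj F2 d) (\<eta>' d) (snd u) = snd (\<mu> d)))" for u
    proof -
      obtain g g' where u: "u = (g, g')"
        by (cases u)
      have "Comp (birep_cat k Q Q') N (L, L', \<psi>') (FObj F d) (\<eta> d, \<eta>' d) u = \<mu> d \<longleftrightarrow>
          Comp (rep_cat k Q) M L (FObj F1 d) (\<eta> d) g = fst (\<mu> d) \<and>
          Comp (rep_cat k Q') M' L' (FObj F2 d) (\<eta>' d) g' = snd (\<mu> d)" for d
        by (simp add: u N F_obj birep_comp_eq prod_eq_iff)
      then show ?thesis
        unfolding u N birep_cat_simps(2) fst_conv snd_conv
        using hom[of g g'] by (auto simp: birep_homs_iff)
    qed
    then show ?thesis
      using ex1 by simp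
  qed
  with birep_cone have "is_limit D (birep_cat k Q Q') F (L, L', \<psi>') (\<lambda>d. (\<eta> d, \<eta>' d))"
    by (simp add: is_limit_def)
  with LL' show ?thesis
    by blast
qed

text \<open>
  Existence together with preservation by the forgetful functor: the limit is assembled from
  limits of the two components, which form a limit in the product category.
\<close>

lemma ex_preserved_birep_limit:
  fixes F :: "('d, 'e, ('v, 'a, 'w, 'b, 'k, 'u) birep, _) fctr"
  assumes k: "cring k" and Q: "wf_digraph Q" and Q': "wf_digraph Q'"
    and small: "small TYPE('u) (Obj D)" and F: "is_functor D (birep_cat k Q Q') F"
  shows "\<exists>L \<eta>. is_limit D (birep_cat k Q Q') F L \<eta> \<and>
    is_limit D (prod_cat (rep_cat k Q) (rep_cat k Q')) (forgetful \<circ>\<^sub>F F)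
      (FObj forgetful L) (\<lambda>d. FArr forgetful L (FObj F d) (\<eta> d))"
proof -
  note functors = is_functor_comp[OF is_functor_comp[OF F is_functor_forgetful[OF Q Q']]]
  have F1: "is_functor D (rep_cat k Q) (fst_fctr \<circ>\<^sub>F forgetful \<circ>\<^sub>F F)"
    by (rule functors[OF is_functor_fst_fctr[OF category_rep_cat[OF Q] category_rep_cat[OF Q']]])
  have F2: "is_functor D (rep_cat k Q') (snd_fctr \<circ>\<^sub>F forgetful \<circ>\<^sub>F F)"
    by (rule functors[OF is_functor_snd_fctr[OF category_rep_cat[OF Q] category_rep_cat[OF Q']]])
  obtain L \<eta> where L: "is_limit D (rep_cat k Q) (fst_fctr \<circ>\<^sub>F forgetful \<circ>\<^sub>F F) L \<eta>"
    using ex_vertexwise_limit[OF k Q small F1] is_limit_if_vertexwise[OF Q F1] by blast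
  obtain L' \<eta>' where L': "is_limit D (rep_cat k Q') (snd_fctr \<circ>\<^sub>F forgetful \<circ>\<^sub>F F) L' \<eta>'"
    using ex_vertexwise_limit[OF k Q' small F2] is_limit_if_vertexwise[OF Q' F2] by blast
  obtain \<psi>' where \<psi>': "is_limit D (birep_cat k Q Q') F (L, L', \<psi>') (\<lambda>d. (\<eta> d, \<eta>' d))"
    using ex_birep_limit[OF k Q Q' small F L L'] by blast
  have "is_limit D (prod_cat (rep_cat k Q) (rep_cat k Q')) (forgetful \<circ>\<^sub>F F)
      (FObj forgetful (L, L', \<psi>')) (\<lambda>d. FArr forgetful (L, L', \<psi>') (FObj F d) (\<eta> d, \<eta>' d))"
    using is_limit_prod_cat[OF L L'] by (simp add: forgetful_def forget_obj_def)
  with \<psi>' show ?thesis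
    by blast
qed

theorem proposition4p1:
  fixes k :: "('k, 'x) ring_scheme"
    and Q :: "('v, 'a) pre_digraph"
    and Q' :: "('w, 'b) pre_digraph"
  assumes "algebraically_closed k"
    and "fin_digraph Q" and "connected Q" and "acyclic_quiver Q"
    and "fin_digraph Q'" and "connected Q'" and "acyclic_quiver Q'"
  defines "Rep \<equiv> (rep_cat k Q :: (('v, 'a, 'k, 'u) rep, _) cat)"
    and "Rep' \<equiv> (rep_cat k Q' :: (('w, 'b, 'k, 'u) rep, _) cat)"
    and "BiRep \<equiv> (birep_cat k Q Q' :: (('v, 'a, 'w, 'b, 'k, 'u) birep, _) cat)"
  shows "complete_category TYPE('u) TYPE('d) TYPE('e) BiRep \<and>
    continuous_functor TYPE('u) TYPE('d) TYPE('e) BiRep (prod_cat Rep Rep') forgetful \<and>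
    (\<forall>(D :: ('d, 'e) cat) F L \<eta> L' \<eta>'.
      small_category TYPE('u) D \<longrightarrow> is_functor D BiRep F \<longrightarrow>
      is_limit D Rep (fst_fctr \<circ>\<^sub>F forgetful \<circ>\<^sub>F F) L \<eta> \<longrightarrow>
      is_limit D Rep' (snd_fctr \<circ>\<^sub>F forgetful \<circ>\<^sub>F F) L' \<eta>' \<longrightarrow>
      (\<exists>\<psi>'. (L, L', \<psi>') \<in> bireps k Q Q' \<and>
        is_limit D BiRep F (L, L', \<psi>') (\<lambda>d. (\<eta> d, \<eta>' d))))"
proof (intro conjI allI impI)
  interpret k: algebraically_closed k by fact
  note k = k.is_cring
  have Q: "wf_digraph Q" and Q': "wf_digraph Q'"
    using \<open>fin_digraph Q\<close> \<open>fin_digraph Q'\<close> by (simp_all add: fin_digraph_def)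
  have BiRep: "category BiRep"
    unfolding BiRep_def by (rule category_birep_cat[OF Q Q'])
  have small: "small TYPE('u) (Obj D)" if "small_category TYPE('u) D" for D :: "('d, 'e) cat"
    using that by (simp add: small_category_def)
  have U: "is_functor BiRep (prod_cat Rep Rep') forgetful"
    unfolding Rep_def Rep'_def BiRep_def by (rule is_functor_forgetful[OF Q Q'])
  note ex = ex_preserved_birep_limit[OF k Q Q' small, folded Rep_def Rep'_def BiRep_def]
  show "complete_category TYPE('u) TYPE('d) TYPE('e) BiRep"
    unfolding complete_category_def using BiRep ex by blast
  show "continuous_functor TYPE('u) TYPE('d) TYPE('e) BiRep (prod_cat Rep Rep') forgetful"
    unfolding continuous_functor_def
    using U ex preserves_limit_if_preserves_one[OF BiRep _ U] by blast
  fix D :: "('d, 'e) cat" and F L \<eta> L' \<eta>'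
  assume "small_category TYPE('u) D" "is_functor D BiRep F"
    "is_limit D Rep (fst_fctr \<circ>\<^sub>F forgetful \<circ>\<^sub>F F) L \<eta>"
    "is_limit D Rep' (snd_fctr \<circ>\<^sub>F forgetful \<circ>\<^sub>F F) L' \<eta>'"
  then show "\<exists>\<psi>'. (L, L', \<psi>') \<in> bireps k Q Q' \<and>
      is_limit D BiRep F (L, L', \<psi>') (\<lambda>d. (\<eta> d, \<eta>' d))"
    using ex_birep_limit[OF k Q Q' small] unfolding Rep_def Rep'_def BiRep_def by blast
qed

end
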